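(* Let $F$ be a finitely generated free group of rank at least $2$ and let $\hat F=\varprojlim F/\gamma_i(F)$ be its pronilpotent completion. Then there exists an uncountable set of countable parafree subgroups $G\subset\hat F$ such that $H_2(G,\mathbb{Z})\neq 0$.
   Context: $\gamma_i(G)$ denotes the lower central series of a group $G$ ($\gamma_1(G)=G$). The free group $F$ is residually nilpotent and is regarded as a subgroup of $\hat F$ via the canonical map. A subgroup $G$ of $\hat F$ is called a parafree subgroup of $\hat F$ if $F\subseteq G\subseteq\hat F$ and the embedding $F\subseteq G$ induces isomorphisms $F/\gamma_i(F)\cong G/\gamma_i(G)$ for all $i\ge1$. $H_2(G,\mathbb{Z})$ is group homology with trivial integer coefficients. *)

theory Defs
  imports "HOL-Algebra.Algebra" "HOL-Library.Countable_Set"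
begin

section \<open>Free groups\<close>

text \<open>A letter \<open>(x, True)\<close> stands for \<open>x\<close> and \<open>(x, False)\<close> for its inverse.\<close>

definition letter_val :: "('a, 'b) monoid_scheme \<Rightarrow> 'a \<times> bool \<Rightarrow> 'a"
  where "letter_val G l = (if snd l then fst l else inv\<^bsub>G\<^esub> (fst l))"

definition word_val :: "('a, 'b) monoid_scheme \<Rightarrow> ('a \<times> bool) list \<Rightarrow> 'a"
  where "word_val G w = foldr (\<otimes>\<^bsub>G\<^esub>) (map (letter_val G) w) \<one>\<^bsub>G\<^esub>"

definition reduced_words :: "'a set \<Rightarrow> ('a \<times> bool) list set"
  where "reduced_words S =
    {w. set w \<subseteq> S \<times> UNIV \<and> successively (\<lambda>l m. fst l = fst m \<longrightarrow> snd l = snd m) w}"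

text \<open>\<open>F\<close> is free with basis \<open>S\<close>: every element is the value of exactly one reduced word in \<open>S\<close>.
  (The universal property would have to quantify over all groups of all types.)\<close>

definition free_group_on :: "('a, 'b) monoid_scheme \<Rightarrow> 'a set \<Rightarrow> bool"
  where "free_group_on F S \<longleftrightarrow>
    group F \<and> S \<subseteq> carrier F \<and> bij_betw (word_val F) (reduced_words S) (carrier F)"

section \<open>Lower central series and pronilpotent completion\<close>

text \<open>The series starts at \<open>\<gamma>\<^sub>1(G) = G\<close>; the index \<open>0\<close> only has a dummy value.\<close>

fun lower_central :: "('a, 'b) monoid_scheme \<Rightarrow> nat \<Rightarrow> 'a set"
  where
    "lower_central G 0 = carrier G"
  | "lower_central G (Suc 0) = carrier G"
  | "lower_central G (Suc (Suc n)) =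
       generate G {h \<otimes>\<^bsub>G\<^esub> g \<otimes>\<^bsub>G\<^esub> inv\<^bsub>G\<^esub> h \<otimes>\<^bsub>G\<^esub> inv\<^bsub>G\<^esub> g | h g.
                     h \<in> lower_central G (Suc n) \<and> g \<in> carrier G}"

text \<open>The inverse limit of the quotients \<open>F/\<gamma>\<^sub>i(F)\<close>, \<open>i \<ge> 1\<close>. For \<open>i \<le> j\<close> the bonding map
  \<open>F/\<gamma>\<^sub>j(F) \<rightarrow> F/\<gamma>\<^sub>i(F)\<close> sends a coset \<open>C\<close> to the product set \<open>\<gamma>\<^sub>i(F) C\<close>.\<close>

definition pronilpotent_completion :: "('a, 'b) monoid_scheme \<Rightarrow> (nat \<Rightarrow> 'a set) monoid"
  where "pronilpotent_completion F =
    (let P = product_group {1..} (\<lambda>i. F Mod lower_central F i)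
     in P\<lparr>carrier := {x \<in> carrier P.
          \<forall>i j. 1 \<le> i \<longrightarrow> i \<le> j \<longrightarrow> lower_central F i <#>\<^bsub>F\<^esub> x j = x i}\<rparr>)"

definition completion_map :: "('a, 'b) monoid_scheme \<Rightarrow> 'a \<Rightarrow> (nat \<Rightarrow> 'a set)"
  where "completion_map F g = (\<lambda>i\<in>{1..}. lower_central F i #>\<^bsub>F\<^esub> g)"

section \<open>Parafree subgroups of the completion\<close>

text \<open>\<open>F\<close> is identified with its image under the canonical map. The homomorphism
  \<open>F/\<gamma>\<^sub>i(F) \<rightarrow> G/\<gamma>\<^sub>i(G)\<close> induced by the embedding \<open>\<iota>\<close> sends a coset \<open>C\<close> to \<open>\<gamma>\<^sub>i(G) \<iota>(C)\<close>.\<close>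

definition parafree_subgroup :: "('a, 'b) monoid_scheme \<Rightarrow> (nat \<Rightarrow> 'a set) set \<Rightarrow> bool"
  where "parafree_subgroup F G \<longleftrightarrow>
    subgroup G (pronilpotent_completion F) \<and>
    completion_map F ` carrier F \<subseteq> G \<and>
    (let \<G> = (pronilpotent_completion F)\<lparr>carrier := G\<rparr>
     in \<forall>i\<ge>1. (\<lambda>C. lower_central \<G> i <#>\<^bsub>\<G>\<^esub> (completion_map F ` C))
                \<in> iso (F Mod lower_central F i) (\<G> Mod lower_central \<G> i))"

section \<open>Group homology with trivial integer coefficients\<close>

text \<open>The complex obtained from the (unnormalised, inhomogeneous) bar resolution of \<open>\<int>\<close> over
  \<open>\<int>G\<close> by taking coinvariants: in degree \<open>n\<close> it is free abelian on the symbols \<open>[g\<^sub>1|...|g\<^sub>n]\<close>.\<close>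

definition bar_chains :: "('a, 'b) monoid_scheme \<Rightarrow> nat \<Rightarrow> ('a list \<Rightarrow>\<^sub>0 int) monoid"
  where "bar_chains G n = free_Abelian_group {gs. length gs = n \<and> set gs \<subseteq> carrier G}"

text \<open>Since \<open>xs ! i\<close> counts from \<open>0\<close>, the inner face number \<open>i\<close> multiplies \<open>g\<^sub>i\<close> and \<open>g\<^sub>i\<^sub>+\<^sub>1\<close>.\<close>

definition bar_face :: "('a, 'b) monoid_scheme \<Rightarrow> nat \<Rightarrow> nat \<Rightarrow> 'a list \<Rightarrow> 'a list"
  where "bar_face G n i gs =
    (if i = 0 then tl gs
     else if i = n then butlast gs
     else take (i - 1) gs @ [gs ! (i - 1) \<otimes>\<^bsub>G\<^esub> gs ! i] @ drop (i + 1) gs)"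

definition bar_boundary ::
    "('a, 'b) monoid_scheme \<Rightarrow> nat \<Rightarrow> ('a list \<Rightarrow>\<^sub>0 int) \<Rightarrow> ('a list \<Rightarrow>\<^sub>0 int)"
  where "bar_boundary G n c =
    (if n = 0 then 0
     else frag_extend (\<lambda>gs. \<Sum>i\<le>n. frag_cmul ((-1) ^ i) (frag_of (bar_face G n i gs))) c)"

definition group_homology ::
    "nat \<Rightarrow> ('a, 'b) monoid_scheme \<Rightarrow> ('a list \<Rightarrow>\<^sub>0 int) set monoid"
  where "group_homology n G =
    (bar_chains G n)\<lparr>carrier := kernel (bar_chains G n) (bar_chains G (n - 1)) (bar_boundary G n)\<rparr>
      Mod (bar_boundary G (Suc n) ` carrier (bar_chains G (Suc n)))"

end

theory Submission
  imports Defs "HOL-Library.Function_Algebras"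
begin

text \<open>
  Let \<open>C\<close> be the pronilpotent completion of \<open>F\<close>. Parafree subgroups of \<open>C\<close> are found as countable
  subgroups \<open>G \<supseteq> F\<close> closed under commutator decompositions. If \<open>w \<in> C\<close> is trivial in \<open>F/\<gamma>\<^sub>n\<^sub>+\<^sub>1\<close>, then \<open>w = \<Prod>\<^sub>x [s\<^sub>x, x]\<close>, where \<open>x\<close> runs over the
  finite basis and each \<open>s\<^sub>x \<in> C\<close> is trivial in \<open>F/\<gamma>\<^sub>n\<close>; this is proved by successive approximation
  (\<open>completion_commutator_prod\<close>). If \<open>G\<close> contains such \<open>s\<^sub>x\<close> for each of its elements \<open>w\<close>, then
  \<open>\<gamma>\<^sub>n(G)\<close> is the kernel of \<open>G \<rightarrow> F/\<gamma>\<^sub>n\<close>, so \<open>G\<close> is parafree (\<open>commutator_closed_parafree\<close>).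
  Closing up under a choice of the \<open>s\<^sub>x\<close> and the group operations shows that every countable
  subset of \<open>C\<close> lies in a countable group of this kind (\<open>commutator_closed_hull\<close>).

  The nonvanishing of \<open>H\<^sub>2\<close> comes from the infinite dihedral group \<open>\<int> \<rtimes> {\<plusminus>1}\<close>. Map one basis element
  \<open>a\<close> of \<open>F\<close> to a reflection, another one \<open>b\<close> to the translation by 1, and the others to the identity.
  This extends to a homomorphism from \<open>C\<close> to the semidirect product of the 2-adic integers \<open>\<int>\<^sub>2\<close> and
  \<open>{\<plusminus>1}\<close>; let \<open>\<epsilon>\<close> and \<open>\<psi>\<close> be its components. An additive map \<open>L\<close> from \<open>\<int>\<^sub>2\<close> to \<open>\<rat>\<close>, necessarily
  discontinuous, that vanishes at 1 yields a derivation \<open>L \<circ> \<psi>\<close> of \<open>C\<close> that vanishes on the basis.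
  The cup product \<open>(g, h) \<mapsto> L(\<psi> g) \<epsilon>(g) M(\<psi> h)\<close> of two of them is a 2-cocycle with trivial
  coefficients. Take elements \<open>u, v\<close> of sign 1 whose images \<open>p, q\<close> in \<open>\<int>\<^sub>2\<close> are linearly independent over
  the rationals together with 1, and \<open>L, M\<close> with \<open>L p = M q = 1\<close> and \<open>L q = 0\<close>. The relation
  \<open>[u, v] = \<Prod>\<^sub>x [s\<^sub>x, x]\<close> makes a 2-cycle. The commutators on the right contribute nothing to the value of
  the cocycle, because the derivations vanish at \<open>x\<close> and \<open>L \<circ> \<psi>\<close> vanishes at \<open>[s\<^sub>x, x]\<close>; the left hand
  side contributes \<open>L p M q - L q M p = 1\<close>, up to sign
  (\<open>homology_2_nontrivial_of_crossed_homs\<close>). This applies to every \<open>G\<close> as above that contains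
  \<open>u\<close> and \<open>v\<close> (\<open>commutator_closed_homology\<close>).

  These groups \<open>G\<close> are countable and cover \<open>C\<close>, which is uncountable since its elements realize all
  2-adic integers. So there are uncountably many of them.
\<close>

section \<open>Commutator calculus and the lower central series\<close>

definition commutator :: "('a, 'b) monoid_scheme \<Rightarrow> 'a \<Rightarrow> 'a \<Rightarrow> 'a"
  where "commutator G x y = x \<otimes>\<^bsub>G\<^esub> y \<otimes>\<^bsub>G\<^esub> inv\<^bsub>G\<^esub> x \<otimes>\<^bsub>G\<^esub> inv\<^bsub>G\<^esub> y"

primrec commutator_prod ::
    "('c, 'd) monoid_scheme \<Rightarrow> ('a \<Rightarrow> 'c) \<Rightarrow> ('a \<Rightarrow> 'c) \<Rightarrow> 'a list \<Rightarrow> 'c"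
  where
    "commutator_prod G s e [] = \<one>\<^bsub>G\<^esub>"
  | "commutator_prod G s e (x # xs) = commutator G (s x) (e x) \<otimes>\<^bsub>G\<^esub> commutator_prod G s e xs"

lemma commutator_prod_cong:
  "(\<And>x. x \<in> set xs \<Longrightarrow> s x = s' x \<and> e x = e' x) \<Longrightarrow>
    commutator_prod G s e xs = commutator_prod G s' e' xs"
  by (induction xs) auto

context group
begin

lemma inv_mult_cancel [simp]:
  "x \<in> carrier G \<Longrightarrow> y \<in> carrier G \<Longrightarrow> inv x \<otimes> (x \<otimes> y) = y"
  "x \<in> carrier G \<Longrightarrow> y \<in> carrier G \<Longrightarrow> x \<otimes> (inv x \<otimes> y) = y"
  by (simp_all add: m_assoc[symmetric])

lemma commutator_closed [simp]:
  "x \<in> carrier G \<Longrightarrow> y \<in> carrier G \<Longrightarrow> commutator G x y \<in> carrier G"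
  by (simp add: commutator_def)

lemma commutator_prod_closed:
  "s \<in> set xs \<rightarrow> carrier G \<Longrightarrow> e \<in> set xs \<rightarrow> carrier G \<Longrightarrow> commutator_prod G s e xs \<in> carrier G"
  by (induction xs) auto

lemma commutator_one_left [simp]: "x \<in> carrier G \<Longrightarrow> commutator G \<one> x = \<one>"
  by (simp add: commutator_def)

lemma commutator_mult_swap:
  "x \<in> carrier G \<Longrightarrow> y \<in> carrier G \<Longrightarrow> commutator G x y \<otimes> (y \<otimes> x) = x \<otimes> y"
  by (simp add: commutator_def m_assoc)

lemma commutator_eq_one_iff:
  assumes "x \<in> carrier G" "y \<in> carrier G"
  shows "commutator G x y = \<one> \<longleftrightarrow> x \<otimes> y = y \<otimes> x"
proof -
  from assms show ?thesis
    by (metis commutator_mult_swap commutator_closed l_one m_closed r_cancel_one')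
qed

lemma commutator_mult_left:
  "x \<in> carrier G \<Longrightarrow> y \<in> carrier G \<Longrightarrow> z \<in> carrier G \<Longrightarrow>
    commutator G (x \<otimes> y) z = x \<otimes> commutator G y z \<otimes> inv x \<otimes> commutator G x z"
  by (simp add: commutator_def m_assoc inv_mult_group)

lemma commutator_mult_right:
  "x \<in> carrier G \<Longrightarrow> y \<in> carrier G \<Longrightarrow> z \<in> carrier G \<Longrightarrow>
    commutator G x (y \<otimes> z) = commutator G x y \<otimes> (y \<otimes> commutator G x z \<otimes> inv y)"
  by (simp add: commutator_def m_assoc inv_mult_group)

end

lemma (in group_hom) hom_commutator:
  "x \<in> carrier G \<Longrightarrow> y \<in> carrier G \<Longrightarrow> h (commutator G x y) = commutator H (h x) (h y)"
  by (simp add: commutator_def)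

lemma (in group_hom) hom_commutator_prod:
  "s \<in> set xs \<rightarrow> carrier G \<Longrightarrow> e \<in> set xs \<rightarrow> carrier G \<Longrightarrow>
    h (commutator_prod G s e xs) = commutator_prod H (\<lambda>x. h (s x)) (\<lambda>x. h (e x)) xs"
  by (induction xs) (auto simp: hom_commutator G.commutator_prod_closed)

subsection \<open>Commutators that are central\<close>

text \<open>The situation of \<open>Y = \<gamma>\<^sub>n\<close> inside \<open>G/\<gamma>\<^sub>n\<^sub>+\<^sub>2\<close>: commutators with one entry in \<open>Y\<close> are bilinear.\<close>

locale central_commutators = group G for G (structure) +
  fixes Y
  assumes Y: "subgroup Y G"
    and central: "\<lbrakk>y \<in> Y; g \<in> carrier G; h \<in> carrier G\<rbrakk> \<Longrightarrow> commutator G y g \<otimes> h = h \<otimes> commutator G y g"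
begin

lemma Y_carrier [simp]: "y \<in> Y \<Longrightarrow> y \<in> carrier G"
  using Y by (rule subgroup.mem_carrier)

lemma commutator_central_conj:
  assumes "y \<in> Y" "g \<in> carrier G" "h \<in> carrier G"
  shows "h \<otimes> commutator G y g \<otimes> inv h = commutator G y g"
  using assms by (simp flip: central add: m_assoc)

lemma commutator_mult_right_central:
  assumes "y \<in> Y" "g \<in> carrier G" "h \<in> carrier G"
  shows "commutator G y (g \<otimes> h) = commutator G y g \<otimes> commutator G y h"
  using assms by (simp add: commutator_mult_right commutator_central_conj)

lemma commutator_inv_right_central:
  assumes "y \<in> Y" "g \<in> carrier G"
  shows "commutator G y (inv g) = inv (commutator G y g)"
proof -
  have "commutator G y (inv g) \<otimes> commutator G y g = commutator G y \<one>"
    using commutator_mult_right_central[of y "inv g" g] assms by simp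
  also have "\<dots> = \<one>"
    using assms by (simp add: commutator_def)
  finally show ?thesis
    using assms by (metis inv_equality commutator_closed inv_closed Y_carrier)
qed

text \<open>The map \<open>[y, _]\<close> is a homomorphism with abelian image, so it vanishes on commutators.\<close>

lemma commutator_commutator_central:
  assumes y: "y \<in> Y" and g: "g \<in> carrier G" and h: "h \<in> carrier G"
  shows "y \<otimes> commutator G g h = commutator G g h \<otimes> y"
proof -
  let ?c = "commutator G y"
  have "?c (commutator G g h) = ?c g \<otimes> ?c h \<otimes> inv ?c g \<otimes> inv ?c h"
    unfolding commutator_def[of G g h]
    using assms by (simp add: commutator_mult_right_central commutator_inv_right_central)
  also have "\<dots> = \<one>"
    using assms central[OF y g, of "?c h"] commutator_eq_one_iff[of "?c g" "?c h"]
    by (simp add: commutator_def[of G "?c g" "?c h"])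
  finally show ?thesis
    using assms by (simp add: commutator_eq_one_iff)
qed

text \<open>If \<open>y \<in> Y\<close>, then \<open>[ys, x] = y[s, x]y\<inverse> [y, x] = [s, x] [y, x]\<close>: correcting the left
  entries by elements of \<open>Y\<close> multiplies the product by the product of the corrections.\<close>

lemma commutator_prod_mult:
  assumes "y \<in> set xs \<rightarrow> Y" "s \<in> set xs \<rightarrow> carrier G" "e \<in> set xs \<rightarrow> carrier G"
  shows "commutator_prod G (\<lambda>x. y x \<otimes> s x) e xs
       = commutator_prod G y e xs \<otimes> commutator_prod G s e xs"
  using assms
proof (induction xs)
  case (Cons x xs)
  then have in_Y: "y x \<in> Y" and carr: "s x \<in> carrier G" "e x \<in> carrier G"
    and y': "y \<in> set xs \<rightarrow> carrier G" and s': "s \<in> set xs \<rightarrow> carrier G"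
    and e': "e \<in> set xs \<rightarrow> carrier G"
    by (auto simp: Pi_iff intro: Y_carrier)
  note closed = commutator_prod_closed[OF y' e'] commutator_prod_closed[OF s' e']
  have "commutator G (y x \<otimes> s x) (e x) = commutator G (s x) (e x) \<otimes> commutator G (y x) (e x)"
    using in_Y carr by (simp add: commutator_mult_left commutator_commutator_central m_assoc)
  also have "\<dots> = commutator G (y x) (e x) \<otimes> commutator G (s x) (e x)"
    using in_Y carr by (simp add: central)
  finally have *: "commutator G (y x \<otimes> s x) (e x) = commutator G (y x) (e x) \<otimes> commutator G (s x) (e x)" .
  have "y \<in> set xs \<rightarrow> Y" using Cons.prems by auto
  then have comm: "h \<otimes> commutator_prod G y e xs = commutator_prod G y e xs \<otimes> h"
    if "h \<in> carrier G" for h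
    using e'
  proof (induction xs)
    case (Cons z zs)
    then have zs: "y z \<in> Y" "e z \<in> carrier G" "commutator_prod G y e zs \<in> carrier G"
      by (auto intro!: commutator_prod_closed simp: Pi_iff intro: Y_carrier)
    then have "h \<otimes> (commutator G (y z) (e z) \<otimes> commutator_prod G y e zs)
        = commutator G (y z) (e z) \<otimes> (h \<otimes> commutator_prod G y e zs)"
      using that central[of "y z" "e z" h] by (metis commutator_closed m_assoc Y_carrier)
    with Cons zs that show ?case by (simp add: m_assoc)
  qed (use that in auto)
  have "commutator_prod G (\<lambda>x. y x \<otimes> s x) e (x # xs)
     = commutator G (y x) (e x) \<otimes> (commutator G (s x) (e x) \<otimes> commutator_prod G y e xs)
        \<otimes> commutator_prod G s e xs"
    using Cons * closed in_Y carr by (simp add: m_assoc)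
  also have "\<dots> = commutator_prod G y e (x # xs) \<otimes> commutator_prod G s e (x # xs)"
    using comm[of "commutator G (s x) (e x)"] closed in_Y carr by (simp add: m_assoc)
  finally show ?case .
qed simp

lemma commutator_prods_subgroup:
  assumes e: "e \<in> set xs \<rightarrow> carrier G"
  shows "subgroup ((\<lambda>y. commutator_prod G y e xs) ` (UNIV \<rightarrow> Y)) G"
proof (rule subgroupI)
  show "(\<lambda>y. commutator_prod G y e xs) ` (UNIV \<rightarrow> Y) \<subseteq> carrier G"
    using e by (auto intro!: commutator_prod_closed simp: Pi_iff intro: Y_carrier)
  show "(\<lambda>y. commutator_prod G y e xs) ` (UNIV \<rightarrow> Y) \<noteq> {}"
    using subgroup.one_closed[OF Y] by (auto intro!: exI[of _ "\<lambda>_. \<one>"])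
  fix a assume "a \<in> (\<lambda>y. commutator_prod G y e xs) ` (UNIV \<rightarrow> Y)"
  then obtain y where y: "y \<in> UNIV \<rightarrow> Y" and a: "a = commutator_prod G y e xs" by auto
  {
    have inv: "(\<lambda>x. inv y x) \<in> UNIV \<rightarrow> Y"
      using y subgroup.m_inv_closed[OF Y] by auto
    have "commutator_prod G (\<lambda>x. inv y x \<otimes> y x) e xs = commutator_prod G (\<lambda>_. \<one>) e xs"
      using y by (intro commutator_prod_cong) (auto simp: Pi_iff)
    also have "\<dots> = \<one>"
      using e by (induction xs) auto
    finally have "commutator_prod G (\<lambda>x. inv y x) e xs \<otimes> a = \<one>"
      using commutator_prod_mult[of "\<lambda>x. inv y x" xs y e] inv y e a by (auto simp: Pi_iff)
    then have "inv a = commutator_prod G (\<lambda>x. inv y x) e xs"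
      unfolding a using y e inv by (intro inv_equality commutator_prod_closed) (auto simp: Pi_iff)
    then show "inv a \<in> (\<lambda>y. commutator_prod G y e xs) ` (UNIV \<rightarrow> Y)"
      using inv by blast
  }
  fix b assume "b \<in> (\<lambda>y. commutator_prod G y e xs) ` (UNIV \<rightarrow> Y)"
  then obtain z where z: "z \<in> UNIV \<rightarrow> Y" and b: "b = commutator_prod G z e xs" by auto
  have "a \<otimes> b = commutator_prod G (\<lambda>x. y x \<otimes> z x) e xs"
    using commutator_prod_mult[of y xs z e] y z e a b by (auto simp: Pi_iff)
  moreover have "(\<lambda>x. y x \<otimes> z x) \<in> UNIV \<rightarrow> Y"
    using y z subgroup.m_closed[OF Y] by auto
  ultimately show "a \<otimes> b \<in> (\<lambda>y. commutator_prod G y e xs) ` (UNIV \<rightarrow> Y)"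
    by blast
qed

lemma commutator_prod_single:
  assumes "e \<in> set xs \<rightarrow> carrier G" "x \<in> set xs" "distinct xs" "y \<in> Y"
  shows "commutator_prod G (\<lambda>z. if z = x then y else \<one>) e xs = commutator G y (e x)"
  using assms
proof (induction xs)
  case (Cons z zs)
  have trivial: "commutator_prod G (\<lambda>z. if z = x then y else \<one>) e ws = \<one>"
    if "x \<notin> set ws" "e \<in> set ws \<rightarrow> carrier G" for ws
    using that by (induction ws) auto
  show ?case
  proof (cases "z = x")
    case True
    with Cons.prems trivial[of zs] show ?thesis by auto
  next
    case False
    moreover from Cons.prems have "e z \<in> carrier G" "e x \<in> carrier G" by auto
    ultimately show ?thesis using Cons by simp
  qed
qed simp

text \<open>By bilinearity a commutator \<open>[y, g]\<close> only depends on how \<open>g\<close> is written in the generators.\<close>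

lemma commutator_in_prods:
  assumes e: "e \<in> set xs \<rightarrow> carrier G" and xs: "distinct xs"
    and g: "g \<in> generate G (e ` set xs)" and y: "y \<in> Y"
  shows "commutator G y g \<in> (\<lambda>y. commutator_prod G y e xs) ` (UNIV \<rightarrow> Y)" (is "_ \<in> ?T")
proof -
  interpret T: subgroup ?T G by (rule commutator_prods_subgroup[OF e])
  have gens: "commutator G y (e x) \<in> ?T" if "x \<in> set xs" for x
    using commutator_prod_single[OF e that xs y] subgroup.one_closed[OF Y] y
    by (intro image_eqI[where x = "\<lambda>z. if z = x then y else \<one>"]) auto
  have carr: "e ` set xs \<subseteq> carrier G" using e by auto
  show ?thesis using g
  proof (induction rule: generate.induct)
    case one
    have "commutator G y \<one> = \<one>" using y by (simp add: commutator_def)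
    then show ?case using T.one_closed by simp
  next
    case (incl h)
    then show ?case using gens by auto
  next
    case (inv h)
    then show ?case using gens carr T.m_inv_closed
      by (auto simp: commutator_inv_right_central[OF y])
  next
    case (eng h1 h2)
    then show ?case using generate_in_carrier[OF carr] T.m_closed
      by (simp add: commutator_mult_right_central[OF y])
  qed
qed

end

subsection \<open>The lower central series\<close>

declare lower_central.simps(3) [simp del]

context group
begin

lemma lower_central_Suc:
  assumes "n \<ge> 1"
  shows "lower_central G (Suc n) =
    generate G {commutator G h g | h g. h \<in> lower_central G n \<and> g \<in> carrier G}"
  using assms by (cases n) (simp_all add: commutator_def lower_central.simps(3))

lemma lower_central_normal: "lower_central G n \<lhd> G"
proof (induction n)
  case (Suc n)
  show ?case
  proof (cases "n = 0")
    case False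
    then have *: "lower_central G (Suc n) =
        generate G {commutator G h g | h g. h \<in> lower_central G n \<and> g \<in> carrier G}"
      by (intro lower_central_Suc) simp
    interpret N: normal "lower_central G n" G by (rule Suc)
    show ?thesis
      unfolding *
    proof (rule normal_generateI)
      show "{commutator G h g | h g. h \<in> lower_central G n \<and> g \<in> carrier G} \<subseteq> carrier G"
        by (auto intro: N.mem_carrier)
      fix c k
      assume "c \<in> {commutator G h g | h g. h \<in> lower_central G n \<and> g \<in> carrier G}"
        and k: "k \<in> carrier G"
      then obtain h g where h: "h \<in> lower_central G n" and g: "g \<in> carrier G"
        and c: "c = commutator G h g" by auto
      note N.mem_carrier[OF h, simp]
      have "k \<otimes> c \<otimes> inv k = commutator G (k \<otimes> h \<otimes> inv k) (k \<otimes> g \<otimes> inv k)"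
        using h g k by (simp add: c commutator_def m_assoc inv_mult_group)
      moreover have "k \<otimes> h \<otimes> inv k \<in> lower_central G n" "k \<otimes> g \<otimes> inv k \<in> carrier G"
        using h g k by (auto intro: N.inv_op_closed2)
      ultimately show "k \<otimes> c \<otimes> inv k \<in>
          {commutator G h g | h g. h \<in> lower_central G n \<and> g \<in> carrier G}"
        by blast
    qed
  qed (simp add: normal_self)
qed (simp add: normal_self)

lemma lower_central_subgroup: "subgroup (lower_central G n) G"
  using lower_central_normal normal_imp_subgroup by blast

lemma lower_central_carrier: "x \<in> lower_central G n \<Longrightarrow> x \<in> carrier G"
  using lower_central_subgroup by (rule subgroup.mem_carrier)

lemma commutator_in_lower_central:
  assumes "h \<in> lower_central G n" "g \<in> carrier G"
  shows "commutator G h g \<in> lower_central G (Suc n)"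
proof (cases "n = 0")
  case False
  with assms show ?thesis
    by (subst lower_central_Suc) (auto intro: generate.incl)
qed (use assms in auto)

lemma lower_central_Suc_subset: "lower_central G (Suc n) \<subseteq> lower_central G n"
proof (cases "n = 0")
  case False
  interpret N: normal "lower_central G n" G by (rule lower_central_normal)
  show ?thesis
  proof (subst lower_central_Suc, use False in simp, rule generate_subgroup_incl)
    show "{commutator G h g | h g. h \<in> lower_central G n \<and> g \<in> carrier G} \<subseteq> lower_central G n"
    proof clarify
      fix h g assume h: "h \<in> lower_central G n" and g: "g \<in> carrier G"
      note lower_central_carrier[OF h, simp]
      have "commutator G h g = h \<otimes> (g \<otimes> inv h \<otimes> inv g)"
        using h g by (simp add: commutator_def m_assoc)
      then show "commutator G h g \<in> lower_central G n"
        using h g by (simp add: N.inv_op_closed2)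
    qed
  qed (rule lower_central_subgroup)
qed simp

lemma lower_central_antimono: "i \<le> j \<Longrightarrow> lower_central G j \<subseteq> lower_central G i"
  by (rule lift_Suc_antimono_le) (rule lower_central_Suc_subset)

lemma lower_central_coset_eq_iff:
  assumes "x \<in> carrier G" "y \<in> carrier G"
  shows "lower_central G n #> x = lower_central G n #> y \<longleftrightarrow> x \<otimes> inv y \<in> lower_central G n"
proof -
  have sub: "lower_central G n \<subseteq> carrier G" by (auto dest: lower_central_carrier)
  have xy: "x \<otimes> inv y \<in> carrier G" using assms by simp
  show ?thesis
    using coset_mult_inv1[OF _ assms sub] coset_mult_inv2[OF _ assms sub]
      coset_join1[OF _ xy lower_central_subgroup] coset_join2[OF xy lower_central_subgroup]
    by metis
qed

lemma central_commutators_Mod_lower_central: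
  "central_commutators (G Mod lower_central G (Suc (Suc n)))
    ((#>) (lower_central G (Suc (Suc n))) ` lower_central G n)"
proof -
  let ?N = "lower_central G (Suc (Suc n))"
  note lower_central_carrier[of _ n, simp]
  interpret N: normal ?N G by (rule lower_central_normal)
  interpret Q: group "G Mod ?N" by (rule N.factorgroup_is_group)
  interpret q: group_hom G "G Mod ?N" "(#>) ?N"
    by (intro group_hom.intro group_hom_axioms.intro is_group Q.is_group N.r_coset_hom_Mod)
  show ?thesis
  proof (intro central_commutators.intro central_commutators_axioms.intro Q.is_group, goal_cases)
    case 1
    show ?case by (intro q.subgroup_img_is_subgroup lower_central_subgroup)
  next
    case (2 y g h)
    then obtain y' g' h' where y: "y = ?N #> y'" "y' \<in> lower_central G n"
      and g: "g = ?N #> g'" "g' \<in> carrier G" and h: "h = ?N #> h'" "h' \<in> carrier G"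
      by (auto simp: FactGroup_def RCOSETS_def)
    have "commutator G (commutator G y' g') h' \<in> ?N"
      using y g h by (intro commutator_in_lower_central)
    then have "(#>) ?N (commutator G (commutator G y' g') h') = \<one>\<^bsub>G Mod ?N\<^esub>"
      by (simp add: coset_join2 lower_central_subgroup)
    then have "commutator (G Mod ?N) (commutator (G Mod ?N) y g) h = \<one>\<^bsub>G Mod ?N\<^esub>"
      using y g h by (simp add: q.hom_commutator)
    moreover have "y \<in> carrier (G Mod ?N)" "g \<in> carrier (G Mod ?N)" "h \<in> carrier (G Mod ?N)"
      using y g h by auto
    ultimately show ?case
      using Q.commutator_closed Q.commutator_eq_one_iff by blast
  qed
qed

text \<open>Modulo \<open>\<gamma>\<^sub>n\<^sub>+\<^sub>2\<close>, commutators are bilinear on \<open>\<gamma>\<^sub>n \<times> G\<close>. So those whose right entry is a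
  generator suffice to generate \<open>\<gamma>\<^sub>n\<^sub>+\<^sub>1\<close>, and the ones with the same generator merge into one.\<close>

lemma lower_central_commutator_prod:
  assumes n: "n \<ge> 1" and xs: "distinct xs" "set xs \<subseteq> carrier G" "generate G (set xs) = carrier G"
    and d: "d \<in> lower_central G (Suc n)"
  obtains y where "y \<in> UNIV \<rightarrow> lower_central G n"
    "lower_central G (Suc (Suc n)) #> d =
     lower_central G (Suc (Suc n)) #> commutator_prod G y (\<lambda>x. x) xs"
proof -
  let ?N = "lower_central G (Suc (Suc n))" and ?Y = "lower_central G n"
  note lower_central_carrier[of _ n, simp] lower_central_carrier[of _ "Suc n", simp]
  let ?q = "(#>) ?N"
  interpret N: normal ?N G by (rule lower_central_normal)
  interpret Q: central_commutators "G Mod ?N" "?q ` ?Y"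
    by (rule central_commutators_Mod_lower_central)
  interpret q: group_hom G "G Mod ?N" ?q
    by (intro group_hom.intro group_hom_axioms.intro is_group Q.is_group N.r_coset_hom_Mod)
  let ?T = "(\<lambda>y. commutator_prod (G Mod ?N) y ?q xs) ` (UNIV \<rightarrow> ?q ` ?Y)"
  have e: "?q \<in> set xs \<rightarrow> carrier (G Mod ?N)" using xs by auto
  interpret T: subgroup ?T "G Mod ?N" by (rule Q.commutator_prods_subgroup[OF e])
  have gen: "?q g \<in> generate (G Mod ?N) (?q ` set xs)" if "g \<in> carrier G" for g
    using that xs q.generate_img[of "set xs"] by auto
  have "?q c \<in> ?T" if "c \<in> lower_central G (Suc n)" for c
    using that unfolding lower_central_Suc[OF n]
  proof (induction rule: generate.induct)
    case one
    then show ?case using T.one_closed by simp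
  next
    case (incl c)
    then show ?case
      using Q.commutator_in_prods[OF e xs(1) gen] by (auto simp: q.hom_commutator)
  next
    case (inv c)
    then have "?q c \<in> ?T" "c \<in> carrier G"
      using Q.commutator_in_prods[OF e xs(1) gen] by (auto simp: q.hom_commutator)
    then show ?case using T.m_inv_closed by simp
  next
    case (eng c1 c2)
    then have "c1 \<in> carrier G" "c2 \<in> carrier G"
      by (auto simp flip: lower_central_Suc[OF n])
    then show ?case using eng T.m_closed by simp
  qed
  from this[OF d] obtain z where z: "z \<in> UNIV \<rightarrow> ?q ` ?Y"
    and dz: "?q d = commutator_prod (G Mod ?N) z ?q xs" by auto
  from z have "\<forall>x. \<exists>y\<in>?Y. z x = ?q y" by auto
  then obtain y where y: "\<And>x. y x \<in> ?Y" "\<And>x. z x = ?q (y x)" by metis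
  have "?q (commutator_prod G y (\<lambda>x. x) xs) = commutator_prod (G Mod ?N) z ?q xs"
    using y xs by (subst q.hom_commutator_prod) (auto intro!: commutator_prod_cong)
  then show thesis
    using y dz by (intro that[of y]) auto
qed

text \<open>Correcting the left entries by \<open>\<gamma>\<^sub>n\<close> changes the product by an arbitrary element of \<open>\<gamma>\<^sub>n\<^sub>+\<^sub>1\<close>,
  up to \<open>\<gamma>\<^sub>n\<^sub>+\<^sub>2\<close>. This is the step of the approximation in the completion.\<close>

lemma commutator_prod_correction:
  assumes y: "y \<in> UNIV \<rightarrow> lower_central G n" and s: "s \<in> set xs \<rightarrow> carrier G"
    and xs: "set xs \<subseteq> carrier G"
  shows "lower_central G (Suc (Suc n)) #> commutator_prod G (\<lambda>x. y x \<otimes> s x) (\<lambda>x. x) xs =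
    lower_central G (Suc (Suc n)) #>
      (commutator_prod G y (\<lambda>x. x) xs \<otimes> commutator_prod G s (\<lambda>x. x) xs)"
proof -
  let ?N = "lower_central G (Suc (Suc n))" and ?Y = "lower_central G n"
  note lower_central_carrier[of _ n, simp] lower_central_carrier[of _ "Suc n", simp]
  let ?q = "(#>) ?N"
  interpret N: normal ?N G by (rule lower_central_normal)
  interpret Q: central_commutators "G Mod ?N" "?q ` ?Y"
    by (rule central_commutators_Mod_lower_central)
  interpret q: group_hom G "G Mod ?N" ?q
    by (intro group_hom.intro group_hom_axioms.intro is_group Q.is_group N.r_coset_hom_Mod)
  have y': "y \<in> set xs \<rightarrow> carrier G" and e: "(\<lambda>x. x) \<in> set xs \<rightarrow> carrier G"
    and yx: "y x \<in> carrier G" for x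
    using y xs by (auto simp: Pi_iff dest: lower_central_carrier)
  have "?q (commutator_prod G (\<lambda>x. y x \<otimes> s x) (\<lambda>x. x) xs)
      = commutator_prod (G Mod ?N) (\<lambda>x. ?q (y x) \<otimes>\<^bsub>G Mod ?N\<^esub> ?q (s x)) ?q xs"
    using s xs yx
    by (subst q.hom_commutator_prod) (auto intro!: commutator_prod_cong q.hom_mult simp del: mult_FactGroup)
  also have "\<dots> = commutator_prod (G Mod ?N) (\<lambda>x. ?q (y x)) ?q xs
      \<otimes>\<^bsub>G Mod ?N\<^esub> commutator_prod (G Mod ?N) (\<lambda>x. ?q (s x)) ?q xs"
    using y s xs by (intro Q.commutator_prod_mult) (auto simp: Pi_iff intro!: q.hom_closed)
  also have "\<dots> = ?q (commutator_prod G y (\<lambda>x. x) xs \<otimes> commutator_prod G s (\<lambda>x. x) xs)"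
    using y' s e by (simp add: q.hom_commutator_prod commutator_prod_closed)
  finally show ?thesis .
qed

end

section \<open>The pronilpotent completion\<close>

definition coherent :: "('a, 'b) monoid_scheme \<Rightarrow> (nat \<Rightarrow> 'a) \<Rightarrow> bool"
  where "coherent G g \<longleftrightarrow> (\<forall>i. g i \<in> carrier G \<and>
    lower_central G i #>\<^bsub>G\<^esub> g (Suc i) = lower_central G i #>\<^bsub>G\<^esub> g i)"

definition coherent_lim :: "('a, 'b) monoid_scheme \<Rightarrow> (nat \<Rightarrow> 'a) \<Rightarrow> nat \<Rightarrow> 'a set"
  where "coherent_lim G g = (\<lambda>i\<in>{1..}. lower_central G i #>\<^bsub>G\<^esub> g i)"

lemma coherent_lim_apply: "i \<ge> 1 \<Longrightarrow> coherent_lim G g i = lower_central G i #>\<^bsub>G\<^esub> g i"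
  by (simp add: coherent_lim_def)

lemma completion_map_eq_lim: "completion_map G x = coherent_lim G (\<lambda>_. x)"
  by (simp add: completion_map_def coherent_lim_def)

lemma coherent_carrier: "coherent G g \<Longrightarrow> g i \<in> carrier G"
  by (simp add: coherent_def)

lemma coherent_lim_eqI:
  "(\<And>i. i \<ge> 1 \<Longrightarrow> lower_central G i #>\<^bsub>G\<^esub> g i = lower_central G i #>\<^bsub>G\<^esub> h i) \<Longrightarrow>
    coherent_lim G g = coherent_lim G h"
  unfolding coherent_lim_def by (rule restrict_ext) simp

lemma mult_pronilpotent_completion:
  "x \<otimes>\<^bsub>pronilpotent_completion G\<^esub> y = (\<lambda>i\<in>{1..}. x i <#>\<^bsub>G\<^esub> y i)"
  by (simp add: pronilpotent_completion_def Let_def)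

lemma carrier_pronilpotent_completion:
  "x \<in> carrier (pronilpotent_completion G) \<longleftrightarrow>
    x \<in> (\<Pi>\<^sub>E i\<in>{1..}. rcosets\<^bsub>G\<^esub> lower_central G i) \<and>
    (\<forall>i j. 1 \<le> i \<longrightarrow> i \<le> j \<longrightarrow> lower_central G i <#>\<^bsub>G\<^esub> x j = x i)"
  by (simp add: pronilpotent_completion_def Let_def FactGroup_def)

context group
begin

abbreviation "\<gamma> \<equiv> lower_central G"
abbreviation "completion \<equiv> pronilpotent_completion G"

lemma lower_central_coset_mult:
  "x \<in> carrier G \<Longrightarrow> y \<in> carrier G \<Longrightarrow> (\<gamma> n #> x) <#> (\<gamma> n #> y) = \<gamma> n #> (x \<otimes> y)"
  using lower_central_normal by (rule normal.rcos_sum)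

lemma lower_central_coset_eq_self_iff:
  "x \<in> carrier G \<Longrightarrow> \<gamma> n #> x = \<gamma> n \<longleftrightarrow> x \<in> \<gamma> n"
  using coset_join1 coset_join2 lower_central_subgroup by metis

lemma lower_central_coset_one [simp]: "\<gamma> n #> \<one> = \<gamma> n"
  by (rule coset_mult_one[OF subgroup.subset[OF lower_central_subgroup]])

lemma lower_central_coset_antimono:
  assumes "\<gamma> j #> x = \<gamma> j #> y" "i \<le> j" "x \<in> carrier G" "y \<in> carrier G"
  shows "\<gamma> i #> x = \<gamma> i #> y"
  using assms lower_central_antimono[of i j] lower_central_coset_eq_iff by blast

lemma lower_central_mult_coset:
  assumes "i \<le> j" "x \<in> carrier G"
  shows "\<gamma> i <#> (\<gamma> j #> x) = \<gamma> i #> x"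
proof (intro equalityI subsetI)
  fix z assume "z \<in> \<gamma> i <#> (\<gamma> j #> x)"
  then obtain a b where "a \<in> \<gamma> i" "b \<in> \<gamma> j" "z = a \<otimes> (b \<otimes> x)"
    by (auto simp: set_mult_def r_coset_def)
  moreover from this have "b \<in> \<gamma> i" using lower_central_antimono[OF assms(1)] by auto
  ultimately have "a \<otimes> b \<in> \<gamma> i" "z = a \<otimes> b \<otimes> x"
    using assms subgroup.m_closed[OF lower_central_subgroup]
    by (auto simp: m_assoc lower_central_carrier[of _ i])
  then show "z \<in> \<gamma> i #> x" by (auto simp: r_coset_def)
next
  fix z assume "z \<in> \<gamma> i #> x"
  then obtain a where "a \<in> \<gamma> i" "z = a \<otimes> x" by (auto simp: r_coset_def)
  moreover have "\<one> \<in> \<gamma> j" using subgroup.one_closed[OF lower_central_subgroup] .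
  ultimately show "z \<in> \<gamma> i <#> (\<gamma> j #> x)"
    using assms by (force simp: set_mult_def r_coset_def)
qed

lemma coherent_le:
  assumes "coherent G g" "i \<le> j"
  shows "\<gamma> i #> g j = \<gamma> i #> g i"
  using assms(2)
proof (induction j rule: dec_induct)
  case (step j)
  have "\<gamma> j #> g (Suc j) = \<gamma> j #> g j" and carr: "g j \<in> carrier G" "g (Suc j) \<in> carrier G"
    using assms(1) by (auto simp: coherent_def)
  then show ?case
    using lower_central_coset_antimono[OF _ step(1) carr(2,1)] step by simp
qed simp

lemma coherent_lim_carrier: "coherent G g \<Longrightarrow> coherent_lim G g \<in> carrier completion"
  unfolding carrier_pronilpotent_completion
proof (intro conjI allI impI)
  assume g: "coherent G g"
  show "coherent_lim G g \<in> (\<Pi>\<^sub>E i\<in>{1..}. rcosets \<gamma> i)"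
    unfolding coherent_lim_def restrict_PiE_iff
    by (intro ballI rcosetsI subgroup.subset[OF lower_central_subgroup] coherent_carrier[OF g])
  show "\<gamma> i <#> coherent_lim G g j = coherent_lim G g i" if "1 \<le> i" "i \<le> j" for i j
    using that coherent_carrier[OF g] coherent_le[OF g that(2)]
    by (simp add: coherent_lim_apply lower_central_mult_coset)
qed

lemma completion_coherent_lim:
  assumes "x \<in> carrier completion"
  obtains g where "coherent G g" "x = coherent_lim G g"
proof -
  have x: "x \<in> (\<Pi>\<^sub>E i\<in>{1..}. rcosets \<gamma> i)"
    and coh: "\<And>i j. 1 \<le> i \<Longrightarrow> i \<le> j \<Longrightarrow> \<gamma> i <#> x j = x i"
    using assms by (auto simp: carrier_pronilpotent_completion)
  have "\<exists>g. g \<in> carrier G \<and> (i \<ge> 1 \<longrightarrow> x i = \<gamma> i #> g)" for i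
  proof (cases "i \<ge> 1")
    case True
    then have "x i \<in> rcosets \<gamma> i" using PiE_mem[OF x] by simp
    then show ?thesis by (auto simp: RCOSETS_def)
  qed auto
  then obtain g where g: "\<And>i. g i \<in> carrier G" "\<And>i. i \<ge> 1 \<Longrightarrow> x i = \<gamma> i #> g i"
    by metis
  have "\<gamma> i #> g (Suc i) = \<gamma> i #> g i" for i
  proof (cases "i \<ge> 1")
    case True
    then show ?thesis
      using coh[of i "Suc i"] g lower_central_mult_coset[of i "Suc i" "g (Suc i)"] by simp
  next
    case False
    then have "i = 0" by simp
    then show ?thesis
      using g lower_central_coset_eq_self_iff[of _ 0] by simp
  qed
  with g have "coherent G g" by (simp add: coherent_def)
  moreover have "x = coherent_lim G g"
  proof
    fix i show "x i = coherent_lim G g i"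
      using g(2)[of i] PiE_arb[OF x, of i] by (cases "i \<ge> 1") (simp_all add: coherent_lim_def)
  qed
  ultimately show thesis by (rule that)
qed

lemma coherent_const: "x \<in> carrier G \<Longrightarrow> coherent G (\<lambda>_. x)"
  by (simp add: coherent_def)

lemma coherent_mult:
  assumes "coherent G g" "coherent G h"
  shows "coherent G (\<lambda>i. g i \<otimes> h i)"
proof -
  have "\<gamma> i #> (g (Suc i) \<otimes> h (Suc i)) = \<gamma> i #> (g i \<otimes> h i)" for i
    using assms by (simp add: coherent_def flip: lower_central_coset_mult)
  with assms show ?thesis by (simp add: coherent_def)
qed

lemma coherent_inv:
  assumes "coherent G g"
  shows "coherent G (\<lambda>i. inv g i)"
proof -
  have "\<gamma> i #> inv g (Suc i) = \<gamma> i #> inv g i" for i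
    using assms by (simp add: coherent_def flip: normal.rcos_inv[OF lower_central_normal])
  with assms show ?thesis by (simp add: coherent_def)
qed

lemma coherent_lim_mult:
  "coherent G g \<Longrightarrow> coherent G h \<Longrightarrow>
    coherent_lim G g \<otimes>\<^bsub>completion\<^esub> coherent_lim G h = coherent_lim G (\<lambda>i. g i \<otimes> h i)"
  unfolding mult_pronilpotent_completion coherent_lim_def[of G "\<lambda>i. g i \<otimes> h i"]
  by (rule restrict_ext) (simp add: coherent_lim_apply coherent_carrier lower_central_coset_mult)

lemma one_completion: "\<one>\<^bsub>completion\<^esub> = coherent_lim G (\<lambda>_. \<one>)"
proof -
  have "\<one>\<^bsub>completion\<^esub> = (\<lambda>i\<in>{1..}. \<gamma> i)"
    by (simp add: pronilpotent_completion_def Let_def)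
  also have "\<dots> = coherent_lim G (\<lambda>_. \<one>)"
    unfolding coherent_lim_def
    by (rule restrict_ext) simp
  finally show ?thesis .
qed

lemma group_completion: "group completion"
proof (rule groupI)
  fix x y assume x: "x \<in> carrier completion" and y: "y \<in> carrier completion"
  obtain f where f: "coherent G f" "x = coherent_lim G f" by (rule completion_coherent_lim[OF x])
  obtain g where g: "coherent G g" "y = coherent_lim G g" by (rule completion_coherent_lim[OF y])
  show "x \<otimes>\<^bsub>completion\<^esub> y \<in> carrier completion"
    using f g by (simp add: coherent_lim_mult coherent_mult coherent_lim_carrier)
next
  show "\<one>\<^bsub>completion\<^esub> \<in> carrier completion"
    by (simp add: one_completion coherent_lim_carrier coherent_const)
next
  fix x y z
  assume x: "x \<in> carrier completion" and y: "y \<in> carrier completion" and z: "z \<in> carrier completion"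
  obtain f where f: "coherent G f" "x = coherent_lim G f" by (rule completion_coherent_lim[OF x])
  obtain g where g: "coherent G g" "y = coherent_lim G g" by (rule completion_coherent_lim[OF y])
  obtain h where h: "coherent G h" "z = coherent_lim G h" by (rule completion_coherent_lim[OF z])
  from f g h show "x \<otimes>\<^bsub>completion\<^esub> y \<otimes>\<^bsub>completion\<^esub> z = x \<otimes>\<^bsub>completion\<^esub> (y \<otimes>\<^bsub>completion\<^esub> z)"
    using coherent_carrier[of G f] coherent_carrier[of G g] coherent_carrier[of G h]
    by (simp add: coherent_lim_mult coherent_mult m_assoc)
next
  fix x assume "x \<in> carrier completion"
  then obtain f where f: "coherent G f" "x = coherent_lim G f" by (rule completion_coherent_lim)
  then show "\<one>\<^bsub>completion\<^esub> \<otimes>\<^bsub>completion\<^esub> x = x"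
    using coherent_carrier[of G f] by (simp add: one_completion coherent_lim_mult coherent_const)
  have "coherent_lim G (\<lambda>i. inv f i) \<otimes>\<^bsub>completion\<^esub> x = \<one>\<^bsub>completion\<^esub>"
    using f coherent_carrier[of G f] by (simp add: one_completion coherent_lim_mult coherent_inv)
  then show "\<exists>y\<in>carrier completion. y \<otimes>\<^bsub>completion\<^esub> x = \<one>\<^bsub>completion\<^esub>"
    using coherent_lim_carrier[OF coherent_inv[OF f(1)]] by blast
qed

lemma coherent_lim_inv:
  assumes "coherent G g"
  shows "inv\<^bsub>completion\<^esub> coherent_lim G g = coherent_lim G (\<lambda>i. inv g i)"
  using assms coherent_carrier[of G g]
  by (intro group.inv_equality[OF group_completion])
    (simp_all add: one_completion coherent_lim_mult coherent_inv coherent_lim_carrier)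

lemma completion_map_hom: "group_hom G completion (completion_map G)"
  by (intro group_hom.intro group_hom_axioms.intro is_group group_completion homI)
    (simp_all add: completion_map_eq_lim coherent_lim_mult coherent_const coherent_lim_carrier)

lemma coherent_commutator:
  "coherent G g \<Longrightarrow> coherent G h \<Longrightarrow> coherent G (\<lambda>i. commutator G (g i) (h i))"
  by (simp add: commutator_def coherent_mult coherent_inv)

lemma coherent_lim_commutator:
  "coherent G g \<Longrightarrow> coherent G h \<Longrightarrow>
    commutator completion (coherent_lim G g) (coherent_lim G h) =
    coherent_lim G (\<lambda>i. commutator G (g i) (h i))"
  by (simp add: commutator_def coherent_lim_mult coherent_lim_inv coherent_mult coherent_inv)

lemma coherent_commutator_prod:
  assumes "\<And>x. x \<in> set xs \<Longrightarrow> coherent G (s x)" "\<And>x. x \<in> set xs \<Longrightarrow> coherent G (e x)"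
  shows "coherent G (\<lambda>i. commutator_prod G (\<lambda>x. s x i) (\<lambda>x. e x i) xs)"
    and "commutator_prod completion (\<lambda>x. coherent_lim G (s x)) (\<lambda>x. coherent_lim G (e x)) xs =
      coherent_lim G (\<lambda>i. commutator_prod G (\<lambda>x. s x i) (\<lambda>x. e x i) xs)"
  using assms
  by (induction xs)
    (simp_all add: coherent_const one_completion coherent_mult coherent_commutator
      coherent_lim_commutator coherent_lim_mult)

subsection \<open>Commutator decompositions in the completion\<close>

text \<open>Successive approximation: for \<open>j \<ge> n\<close>, a decomposition modulo \<open>\<gamma>\<^sub>j\<^sub>+\<^sub>1\<close> is improved to one
  modulo \<open>\<gamma>\<^sub>j\<^sub>+\<^sub>2\<close> by multiplying the left entries with elements of \<open>\<gamma>\<^sub>j\<close>. So the left entries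
  converge. Starting with the trivial decomposition at \<open>j = n\<close>, they stay trivial at level \<open>n\<close>.\<close>

lemma completion_commutator_prod:
  assumes n: "n \<ge> 1" and xs: "distinct xs" "set xs \<subseteq> carrier G" "generate G (set xs) = carrier G"
    and w: "w \<in> carrier completion" "w (Suc n) = \<gamma> (Suc n)"
  obtains s where "s \<in> UNIV \<rightarrow> {v \<in> carrier completion. v n = \<gamma> n}"
    "w = commutator_prod completion s (completion_map G) xs"
proof -
  obtain g where g: "coherent G g" and w_lim: "w = coherent_lim G g"
    using w(1) by (rule completion_coherent_lim)
  note g_carr = coherent_carrier[OF g]
  let ?cp = "\<lambda>t. commutator_prod G t (\<lambda>x. x) xs"
  have cp_carr: "?cp t \<in> carrier G" if "\<And>x. t x \<in> carrier G" for t
    using that xs by (intro commutator_prod_closed) auto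
  have cp_one: "?cp (\<lambda>_. \<one>) = \<one>"
    using xs(2) by (induction xs) auto
  have start: "\<gamma> (Suc n) #> g (Suc n) = \<gamma> (Suc n)"
    using w w_lim by (simp add: coherent_lim_apply)
  \<comment> \<open>The \<open>k\<close>-th approximation is a decomposition modulo \<open>\<gamma>\<^sub>n\<^sub>+\<^sub>k\<^sub>+\<^sub>1\<close>.\<close>
  define approx where "approx k t \<longleftrightarrow> (\<forall>x. t x \<in> carrier G) \<and> (k = 0 \<longrightarrow> t = (\<lambda>_. \<one>)) \<and>
    \<gamma> (Suc (n + k)) #> g (Suc (n + k)) = \<gamma> (Suc (n + k)) #> ?cp t" for k and t :: "'a \<Rightarrow> 'a"
  have ex_approx: "\<exists>t. \<forall>k. approx k (t k) \<and> (\<forall>x. \<gamma> (n + k) #> t (Suc k) x = \<gamma> (n + k) #> t k x)"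
  proof (rule dependent_nat_choice)
    show "\<exists>t. approx 0 t"
      using start cp_one
      by (intro exI[of _ "\<lambda>_. \<one>"]) (auto simp: approx_def)
  next
    fix t k assume t: "approx k t"
    define j where "j = n + k"
    have t_carr: "t x \<in> carrier G" for x using t by (simp add: approx_def)
    note cpt = cp_carr[of t, OF t_carr]
    define d where "d = g (Suc (Suc j)) \<otimes> inv ?cp t"
    have "\<gamma> (Suc j) #> g (Suc (Suc j)) = \<gamma> (Suc j) #> ?cp t"
      using t g by (simp add: approx_def coherent_def j_def)
    then have "d \<in> \<gamma> (Suc j)"
      unfolding d_def using g_carr cpt by (simp add: lower_central_coset_eq_iff)
    moreover have "j \<ge> 1" using n by (simp add: j_def)
    ultimately obtain y where y: "y \<in> UNIV \<rightarrow> \<gamma> j"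
      and dy: "\<gamma> (Suc (Suc j)) #> d = \<gamma> (Suc (Suc j)) #> ?cp y"
      using lower_central_commutator_prod xs by metis
    have y_carr: "y x \<in> carrier G" for x
      using y lower_central_carrier[of "y x" j] by auto
    have d_carr: "d \<in> carrier G" using g_carr cpt by (simp add: d_def)
    have "\<gamma> (Suc (Suc j)) #> ?cp (\<lambda>x. y x \<otimes> t x) = \<gamma> (Suc (Suc j)) #> (?cp y \<otimes> ?cp t)"
      using y t_carr xs by (intro commutator_prod_correction) auto
    also have "\<dots> = \<gamma> (Suc (Suc j)) #> (d \<otimes> ?cp t)"
      using dy d_carr cpt cp_carr[of y, OF y_carr] by (simp flip: lower_central_coset_mult)
    also have "d \<otimes> ?cp t = g (Suc (Suc j))"
      using g_carr cpt by (simp add: d_def m_assoc)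
    finally have "approx (Suc k) (\<lambda>x. y x \<otimes> t x)"
      using y_carr t_carr by (simp add: approx_def j_def)
    moreover have "\<gamma> j #> (y x \<otimes> t x) = \<gamma> j #> t x" for x
      using y y_carr t_carr by (subst lower_central_coset_eq_iff) (auto simp: m_assoc)
    ultimately show "\<exists>t'. approx (Suc k) t' \<and> (\<forall>x. \<gamma> (n + k) #> t' x = \<gamma> (n + k) #> t x)"
      unfolding j_def by blast
  qed
  then obtain t where t: "\<And>k. approx k (t k)"
    and step: "\<And>k x. \<gamma> (n + k) #> t (Suc k) x = \<gamma> (n + k) #> t k x" by blast
  have t_carr: "t k x \<in> carrier G" and t0: "t 0 = (\<lambda>_. \<one>)"
    and t_approx: "\<gamma> (Suc (n + k)) #> g (Suc (n + k)) = \<gamma> (Suc (n + k)) #> ?cp (t k)" for k x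
    using t[of k] t[of 0] by (auto simp: approx_def)
  define s where "s x = (\<lambda>j. t (j - n) x)" for x
  have coh: "coherent G (s x)" for x
    unfolding coherent_def
  proof (intro allI conjI)
    fix j
    show "s x j \<in> carrier G" by (simp add: s_def t_carr)
    show "\<gamma> j #> s x (Suc j) = \<gamma> j #> s x j"
      using step[of "j - n" x] by (cases "j \<ge> n") (simp_all add: s_def Suc_diff_le)
  qed
  have "w = coherent_lim G (\<lambda>j. ?cp (\<lambda>x. s x j))"
    unfolding w_lim
  proof (rule coherent_lim_eqI)
    fix j :: nat assume "j \<ge> 1"
    show "\<gamma> j #> g j = \<gamma> j #> ?cp (\<lambda>x. s x j)"
    proof (cases "j \<ge> n")
      case True
      have "\<gamma> (Suc j) #> g (Suc j) = \<gamma> (Suc j) #> ?cp (\<lambda>x. s x j)"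
        using t_approx[of "j - n"] True by (simp add: s_def)
      then have "\<gamma> j #> g (Suc j) = \<gamma> j #> ?cp (\<lambda>x. s x j)"
        using g_carr cp_carr[of "\<lambda>x. s x j"] t_carr
        by (intro lower_central_coset_antimono[of "Suc j" _ _ j]) (auto simp: s_def)
      then show ?thesis using g by (simp add: coherent_def)
    next
      case False
      have "\<gamma> j #> g j = \<gamma> j #> g (Suc n)"
        using coherent_le[OF g, of j "Suc n"] False by simp
      also have "\<dots> = \<gamma> j #> \<one>"
        using start g_carr False
        by (intro lower_central_coset_antimono[of "Suc n" _ _ j]) auto
      finally show ?thesis using False cp_one by (simp add: s_def t0)
    qed
  qed
  also have "\<dots> = commutator_prod completion (\<lambda>x. coherent_lim G (s x)) (completion_map G) xs"
  proof -
    have "completion_map G = (\<lambda>x. coherent_lim G (\<lambda>_. x))"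
      by (rule ext) (rule completion_map_eq_lim)
    moreover have "coherent G (\<lambda>_. x)" if "x \<in> set xs" for x
      using that xs(2) by (intro coherent_const) auto
    ultimately show ?thesis
      using coherent_commutator_prod(2)[of xs s "\<lambda>x _. x"] coh by simp
  qed
  finally have "w = commutator_prod completion (\<lambda>x. coherent_lim G (s x)) (completion_map G) xs" .
  moreover have "coherent_lim G (s x) n = \<gamma> n" for x
    using n by (simp add: coherent_lim_apply s_def t0)
  ultimately show thesis
    using coh by (intro that[of "\<lambda>x. coherent_lim G (s x)"]) (auto intro: coherent_lim_carrier)
qed

end

section \<open>Countable parafree subgroups\<close>

lemma countable_closure_binary:
  fixes F :: "('a \<Rightarrow> 'a \<Rightarrow> 'a) set"
  assumes "countable C" "countable F" "C \<subseteq> U" "\<And>f a b. f \<in> F \<Longrightarrow> a \<in> U \<Longrightarrow> b \<in> U \<Longrightarrow> f a b \<in> U"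
  obtains D where "countable D" "C \<subseteq> D" "D \<subseteq> U" "\<And>f a b. f \<in> F \<Longrightarrow> a \<in> D \<Longrightarrow> b \<in> D \<Longrightarrow> f a b \<in> D"
proof -
  define step where "step A = A \<union> (\<Union>f\<in>F. \<Union>a\<in>A. (\<lambda>b. f a b) ` A)" for A
  define E where "E k = (step ^^ k) C" for k
  have E0: "E 0 = C" and E_Suc: "E (Suc k) = step (E k)" for k by (simp_all add: E_def)
  have sub: "E k \<subseteq> U" for k
  proof (induction k)
    case (Suc k)
    then show ?case unfolding E_Suc step_def using assms(4) by blast
  qed (simp add: E0 assms(3))
  have count: "countable (E k)" for k
  proof (induction k)
    case (Suc k)
    then show ?case unfolding E_Suc step_def using assms(2) by simp
  qed (simp add: E0 assms(1))
  have mono: "E i \<subseteq> E j" if "i \<le> j" for i j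
    using that by (rule lift_Suc_mono_le[rotated]) (auto simp: E_Suc step_def)
  show thesis
  proof (rule that[of "\<Union>k. E k"])
    show "C \<subseteq> (\<Union>k. E k)" using E0 by blast
    fix f a b assume f: "f \<in> F" and "a \<in> (\<Union>k. E k)" "b \<in> (\<Union>k. E k)"
    then obtain i j where "a \<in> E i" "b \<in> E j" by auto
    then have "a \<in> E (max i j)" "b \<in> E (max i j)"
      using mono[of i "max i j"] mono[of j "max i j"] by auto
    then have "f a b \<in> E (Suc (max i j))"
      using f by (auto simp: E_Suc step_def)
    then show "f a b \<in> (\<Union>k. E k)" by blast
  qed (use sub count in auto)
qed

lemma commutator_restrict:
  assumes "group G" "subgroup H G" "x \<in> H" "y \<in> H"
  shows "commutator (G\<lparr>carrier := H\<rparr>) x y = commutator G x y"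
  using assms by (simp add: commutator_def group.m_inv_consistent)

lemma (in group) lower_central_restrict_Suc:
  assumes "subgroup H G" "n \<ge> 1"
  shows "lower_central (G\<lparr>carrier := H\<rparr>) (Suc n) = generate (G\<lparr>carrier := H\<rparr>)
    {commutator G h g | h g. h \<in> lower_central (G\<lparr>carrier := H\<rparr>) n \<and> g \<in> H}"
proof -
  interpret H: group "G\<lparr>carrier := H\<rparr>"
    using assms(1) is_group by (rule subgroup.subgroup_is_group)
  have "{commutator (G\<lparr>carrier := H\<rparr>) h g | h g.
      h \<in> lower_central (G\<lparr>carrier := H\<rparr>) n \<and> g \<in> carrier (G\<lparr>carrier := H\<rparr>)}
    = {commutator G h g | h g. h \<in> lower_central (G\<lparr>carrier := H\<rparr>) n \<and> g \<in> H}"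
    using commutator_restrict[OF is_group assms(1)] H.lower_central_carrier[of _ n]
    by (force intro!: Collect_cong)
  then show ?thesis
    using H.lower_central_Suc[OF assms(2)] by simp
qed

context group
begin

lemma level_kernel_subgroup:
  assumes "n \<ge> 1"
  shows "subgroup {w \<in> carrier completion. w n = \<gamma> n} completion"
proof (rule group.subgroupI[OF group_completion])
  interpret C: group completion by (rule group_completion)
  have one: "\<one>\<^bsub>completion\<^esub> n = \<gamma> n"
    using assms by (simp add: one_completion coherent_lim_apply)
  show "{w \<in> carrier completion. w n = \<gamma> n} \<noteq> {}"
    using one C.one_closed by blast
  fix a assume a: "a \<in> {w \<in> carrier completion. w n = \<gamma> n}"
  then obtain g where g: "coherent G g" "a = coherent_lim G g"
    using completion_coherent_lim by blast
  with a have gn: "g n \<in> \<gamma> n"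
    using assms coherent_carrier[OF g(1)] by (simp add: coherent_lim_apply lower_central_coset_eq_self_iff)
  then have "inv g n \<in> \<gamma> n"
    by (rule subgroup.m_inv_closed[OF lower_central_subgroup])
  then show "inv\<^bsub>completion\<^esub> a \<in> {w \<in> carrier completion. w n = \<gamma> n}"
    using g a assms coherent_carrier[OF g(1)]
    by (simp add: coherent_lim_inv coherent_lim_apply lower_central_coset_eq_self_iff
        coherent_lim_carrier coherent_inv)
  fix b assume b: "b \<in> {w \<in> carrier completion. w n = \<gamma> n}"
  then obtain h where h: "coherent G h" "b = coherent_lim G h"
    using completion_coherent_lim by blast
  with b have hn: "h n \<in> \<gamma> n"
    using assms coherent_carrier[OF h(1)] by (simp add: coherent_lim_apply lower_central_coset_eq_self_iff)
  have "g n \<otimes> h n \<in> \<gamma> n"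
    using gn hn by (rule subgroup.m_closed[OF lower_central_subgroup])
  then show "a \<otimes>\<^bsub>completion\<^esub> b \<in> {w \<in> carrier completion. w n = \<gamma> n}"
    using g h a b assms coherent_carrier[OF g(1)] coherent_carrier[OF h(1)]
    by (simp add: coherent_lim_mult coherent_lim_apply lower_central_coset_eq_self_iff
        coherent_lim_carrier coherent_mult)
qed auto

lemma completion_level_one: "w \<in> carrier completion \<Longrightarrow> w 1 = \<gamma> 1"
  by (metis completion_coherent_lim coherent_carrier coherent_lim_apply le_refl
      lower_central_coset_eq_self_iff lower_central.simps(2) One_nat_def)

lemma commutator_level:
  assumes "n \<ge> 1" "v \<in> carrier completion" "v n = \<gamma> n" "w \<in> carrier completion"
  shows "commutator completion v w (Suc n) = \<gamma> (Suc n)"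
proof -
  obtain g where g: "coherent G g" "v = coherent_lim G g"
    using assms(2) by (rule completion_coherent_lim)
  obtain h where h: "coherent G h" "w = coherent_lim G h"
    using assms(4) by (rule completion_coherent_lim)
  note carr = coherent_carrier[OF g(1)] coherent_carrier[OF h(1)]
  have "\<gamma> n #> g (Suc n) = \<gamma> n"
    using assms(1,3) g by (simp add: coherent_lim_apply coherent_def)
  then have "g (Suc n) \<in> \<gamma> n"
    using carr by (simp add: lower_central_coset_eq_self_iff)
  then have "commutator G (g (Suc n)) (h (Suc n)) \<in> \<gamma> (Suc n)"
    using carr by (intro commutator_in_lower_central)
  then show ?thesis
    using g h carr by (simp add: coherent_lim_commutator coherent_lim_apply lower_central_coset_eq_self_iff)
qed

text \<open>Closure under the decompositions above, at all levels. It makes the filtration that a subgroup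
  inherits from the completion coincide with its own lower central series.\<close>

definition commutator_closed_subgroup :: "'a list \<Rightarrow> (nat \<Rightarrow> 'a set) set \<Rightarrow> bool"
  where "commutator_closed_subgroup xs H \<longleftrightarrow> subgroup H completion \<and>
    completion_map G ` carrier G \<subseteq> H \<and>
    (\<forall>n\<ge>1. \<forall>w\<in>H. w (Suc n) = \<gamma> (Suc n) \<longrightarrow>
      (\<exists>s. (\<forall>x\<in>set xs. s x \<in> H \<and> s x n = \<gamma> n) \<and>
        w = commutator_prod completion s (completion_map G) xs))"

text \<open>An element of \<open>H\<close> that is trivial at level \<open>n + 1\<close> is a product of commutators whose left
  entries lie in \<open>H\<close> and are trivial at level \<open>n\<close>, hence by induction lie in \<open>\<gamma>\<^sub>n(H)\<close>.\<close>

lemma commutator_closed_lower_central: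
  assumes H: "commutator_closed_subgroup xs H" and xs: "set xs \<subseteq> carrier G" and "n \<ge> 1"
  shows "lower_central (completion\<lparr>carrier := H\<rparr>) n = {w \<in> H. w n = \<gamma> n}"
  using \<open>n \<ge> 1\<close>
proof (induction n rule: dec_induct)
  case base
  have "w 1 = \<gamma> 1" if "w \<in> H" for w
    using that H completion_level_one subgroup.mem_carrier
    unfolding commutator_closed_subgroup_def by metis
  then show ?case by auto
next
  case (step n)
  have sub: "subgroup H completion" and map: "completion_map G ` carrier G \<subseteq> H"
    using H by (auto simp: commutator_closed_subgroup_def)
  let ?H = "completion\<lparr>carrier := H\<rparr>"
  interpret C: group completion by (rule group_completion)
  interpret H: group ?H using sub group_completion by (rule subgroup.subgroup_is_group)
  interpret sub: subgroup H completion by (rule sub)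
  have level: "subgroup {w \<in> H. w (Suc n) = \<gamma> (Suc n)} ?H"
  proof -
    have "subgroup (H \<inter> {w \<in> carrier completion. w (Suc n) = \<gamma> (Suc n)}) completion"
      using sub level_kernel_subgroup[of "Suc n"] by (intro C.subgroups_Inter_pair) auto
    also have "H \<inter> {w \<in> carrier completion. w (Suc n) = \<gamma> (Suc n)} = {w \<in> H. w (Suc n) = \<gamma> (Suc n)}"
      by auto
    finally show ?thesis
      using sub by (intro C.subgroup_incl) auto
  qed
  let ?gens = "{commutator completion h g | h g. h \<in> lower_central ?H n \<and> g \<in> H}"
  have gen: "lower_central ?H (Suc n) = generate ?H ?gens"
    using C.lower_central_restrict_Suc[OF sub step(1)] .
  show ?case
  proof
    show "lower_central ?H (Suc n) \<subseteq> {w \<in> H. w (Suc n) = \<gamma> (Suc n)}"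
      unfolding gen
    proof (rule H.generate_subgroup_incl[OF _ level])
      show "?gens \<subseteq> {w \<in> H. w (Suc n) = \<gamma> (Suc n)}"
      proof clarify
        fix h g assume "h \<in> lower_central ?H n" "g \<in> H"
        then have hg: "h \<in> H" "h n = \<gamma> n" "g \<in> H" using step by auto
        moreover have "commutator completion h g \<in> H"
          using H.commutator_closed[of h g] commutator_restrict[OF group_completion sub] hg by simp
        ultimately show "commutator completion h g \<in> H \<and>
            commutator completion h g (Suc n) = \<gamma> (Suc n)"
          using commutator_level[of n h g] step by auto
      qed
    qed
    show "{w \<in> H. w (Suc n) = \<gamma> (Suc n)} \<subseteq> lower_central ?H (Suc n)"
    proof clarify
      fix w assume "w \<in> H" "w (Suc n) = \<gamma> (Suc n)"
      then obtain s where s: "\<forall>x\<in>set xs. s x \<in> H \<and> s x n = \<gamma> n"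
        and w: "w = commutator_prod completion s (completion_map G) xs"
        using H step(1) unfolding commutator_closed_subgroup_def by blast
      have "commutator_prod completion s (completion_map G) ys \<in> generate ?H ?gens"
        if "set ys \<subseteq> set xs" for ys
        using that
      proof (induction ys)
        case Nil
        show ?case using generate.one[of ?H ?gens] by simp
      next
        case (Cons y ys)
        then have "y \<in> set xs" "y \<in> carrier G" using xs by auto
        then have "s y \<in> lower_central ?H n" "completion_map G y \<in> H"
          using step s map by auto
        then have "commutator completion (s y) (completion_map G y) \<in> generate ?H ?gens"
          by (intro generate.incl) blast
        moreover have "commutator_prod completion s (completion_map G) ys \<in> generate ?H ?gens"
          using Cons by simp
        ultimately show ?case using generate.eng[of _ ?H ?gens] by simp
      qed
      then show "w \<in> lower_central ?H (Suc n)" by (simp add: w gen)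
    qed
  qed
qed

text \<open>By the previous lemma \<open>H/\<gamma>\<^sub>i(H)\<close> embeds into \<open>G/\<gamma>\<^sub>i(G)\<close> as the image of \<open>H\<close>, which is everything
  because \<open>G \<subseteq> H\<close>.\<close>

lemma commutator_closed_parafree:
  assumes H: "commutator_closed_subgroup xs H" and xs: "set xs \<subseteq> carrier G"
  shows "parafree_subgroup G H"
proof -
  let ?H = "completion\<lparr>carrier := H\<rparr>"
  let ?\<iota> = "completion_map G"
  have sub: "subgroup H completion" and map: "?\<iota> ` carrier G \<subseteq> H"
    using H by (auto simp: commutator_closed_subgroup_def)
  interpret C: group completion by (rule group_completion)
  interpret H: group ?H using sub group_completion by (rule subgroup.subgroup_is_group)
  interpret sub: subgroup H completion by (rule sub)
  interpret \<iota>: group_hom G completion ?\<iota> by (rule completion_map_hom)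
  have "(\<lambda>K. lower_central ?H i <#>\<^bsub>?H\<^esub> (?\<iota> ` K)) \<in> iso (G Mod \<gamma> i) (?H Mod lower_central ?H i)"
    if i: "i \<ge> 1" for i
  proof -
    let ?N = "lower_central ?H i"
    let ?f = "\<lambda>K. ?N <#>\<^bsub>?H\<^esub> (?\<iota> ` K)"
    interpret N: normal ?N ?H by (rule H.lower_central_normal)
    interpret \<gamma>: normal "\<gamma> i" G by (rule lower_central_normal)
    have N: "?N = {w \<in> H. w i = \<gamma> i}"
      using commutator_closed_lower_central[OF H xs i] .
    have \<iota>N: "?\<iota> z \<in> ?N \<longleftrightarrow> z \<in> \<gamma> i" if "z \<in> carrier G" for z
      using that map i
      by (auto simp: N completion_map_eq_lim coherent_lim_apply lower_central_coset_eq_self_iff)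
    have f: "?f (\<gamma> i #> g) = ?N #>\<^bsub>?H\<^esub> ?\<iota> g" if g: "g \<in> carrier G" for g
    proof (intro equalityI subsetI)
      fix w assume "w \<in> ?f (\<gamma> i #> g)"
      then obtain n z where nz: "n \<in> ?N" "z \<in> \<gamma> i" "w = n \<otimes>\<^bsub>completion\<^esub> ?\<iota> (z \<otimes> g)"
        by (auto simp: set_mult_def r_coset_def)
      have zG: "z \<in> carrier G" using nz(2) by (rule lower_central_carrier)
      have "n \<otimes>\<^bsub>completion\<^esub> ?\<iota> z \<in> ?N"
        using N.m_closed[OF nz(1), of "?\<iota> z"] \<iota>N[OF zG] nz(2) by simp
      moreover have "n \<in> carrier completion" using nz(1) by (auto simp: N)
      then have "w = n \<otimes>\<^bsub>completion\<^esub> ?\<iota> z \<otimes>\<^bsub>completion\<^esub> ?\<iota> g"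
        using nz(3) zG g by (simp add: C.m_assoc)
      ultimately show "w \<in> ?N #>\<^bsub>?H\<^esub> ?\<iota> g" by (auto simp: r_coset_def)
    next
      fix w assume "w \<in> ?N #>\<^bsub>?H\<^esub> ?\<iota> g"
      then obtain n where "n \<in> ?N" "w = n \<otimes>\<^bsub>completion\<^esub> ?\<iota> g"
        by (auto simp: r_coset_def)
      moreover have "g \<in> \<gamma> i #> g" using g \<gamma>.one_closed by (force simp: r_coset_def)
      ultimately show "w \<in> ?f (\<gamma> i #> g)" by (auto simp: set_mult_def)
    qed
    have \<iota>H: "?\<iota> g \<in> carrier ?H" if "g \<in> carrier G" for g using that map by auto
    have cosets: "\<exists>g\<in>carrier G. K = \<gamma> i #> g" if "K \<in> carrier (G Mod \<gamma> i)" for K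
      using that by (auto simp: FactGroup_def RCOSETS_def)
    show ?thesis
      unfolding iso_def bij_betw_def
    proof (intro CollectI conjI homI)
      fix K assume "K \<in> carrier (G Mod \<gamma> i)"
      then show "?f K \<in> carrier (?H Mod ?N)"
        using cosets f \<iota>H by (force simp: FactGroup_def RCOSETS_def)
    next
      fix K L assume K: "K \<in> carrier (G Mod \<gamma> i)" and L: "L \<in> carrier (G Mod \<gamma> i)"
      obtain g where g: "g \<in> carrier G" "K = \<gamma> i #> g" using cosets[OF K] by blast
      obtain h where h: "h \<in> carrier G" "L = \<gamma> i #> h" using cosets[OF L] by blast
      have "?f (K \<otimes>\<^bsub>G Mod \<gamma> i\<^esub> L) = ?f (\<gamma> i #> (g \<otimes> h))"
        using g h by (simp add: FactGroup_def lower_central_coset_mult)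
      also have "\<dots> = ?N #>\<^bsub>?H\<^esub> (?\<iota> g \<otimes>\<^bsub>?H\<^esub> ?\<iota> h)"
        using g h f[of "g \<otimes> h"] by simp
      also have "\<dots> = ?f K \<otimes>\<^bsub>?H Mod ?N\<^esub> ?f L"
        using N.rcos_sum[OF \<iota>H \<iota>H] g h f by (simp add: FactGroup_def)
      finally show "?f (K \<otimes>\<^bsub>G Mod \<gamma> i\<^esub> L) = ?f K \<otimes>\<^bsub>?H Mod ?N\<^esub> ?f L" .
    next
      show "inj_on ?f (carrier (G Mod \<gamma> i))"
      proof (rule inj_onI)
        fix K L assume K: "K \<in> carrier (G Mod \<gamma> i)" and L: "L \<in> carrier (G Mod \<gamma> i)" and "?f K = ?f L"
        obtain g where g: "g \<in> carrier G" "K = \<gamma> i #> g" using cosets[OF K] by blast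
        obtain h where h: "h \<in> carrier G" "L = \<gamma> i #> h" using cosets[OF L] by blast
        have "?N #>\<^bsub>?H\<^esub> ?\<iota> g = ?N #>\<^bsub>?H\<^esub> ?\<iota> h" using \<open>?f K = ?f L\<close> g h f by simp
        then have "?\<iota> g \<otimes>\<^bsub>?H\<^esub> inv\<^bsub>?H\<^esub> ?\<iota> h \<in> ?N"
          using H.lower_central_coset_eq_iff \<iota>H g h by blast
        moreover have "?\<iota> g \<otimes>\<^bsub>?H\<^esub> inv\<^bsub>?H\<^esub> ?\<iota> h = ?\<iota> (g \<otimes> inv h)"
          using g h \<iota>H C.m_inv_consistent[OF sub, of "?\<iota> h"] by simp
        ultimately have "g \<otimes> inv h \<in> \<gamma> i"
          using \<iota>N[of "g \<otimes> inv h"] g h by simp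
        then show "K = L"
          using g h lower_central_coset_eq_iff by blast
      qed
    next
      show "?f ` carrier (G Mod \<gamma> i) = carrier (?H Mod ?N)"
      proof (intro equalityI subsetI)
        fix M assume "M \<in> ?f ` carrier (G Mod \<gamma> i)"
        then show "M \<in> carrier (?H Mod ?N)"
          using cosets f \<iota>H by (force simp: FactGroup_def RCOSETS_def)
      next
        fix M assume "M \<in> carrier (?H Mod ?N)"
        then obtain w where w: "w \<in> H" "M = ?N #>\<^bsub>?H\<^esub> w"
          by (auto simp: FactGroup_def RCOSETS_def)
        obtain g where g: "coherent G g" "w = coherent_lim G g"
          using w(1) sub.mem_carrier completion_coherent_lim by blast
        have gi: "g i \<in> carrier G" using g by (simp add: coherent_carrier)
        have "w \<otimes>\<^bsub>completion\<^esub> inv\<^bsub>completion\<^esub> ?\<iota> (g i) = coherent_lim G (\<lambda>j. g j \<otimes> inv g i)"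
          using g gi by (simp add: completion_map_eq_lim coherent_lim_inv coherent_lim_mult
              coherent_const coherent_inv)
        then have "(w \<otimes>\<^bsub>completion\<^esub> inv\<^bsub>completion\<^esub> ?\<iota> (g i)) i = \<gamma> i"
          using i gi by (simp add: coherent_lim_apply)
        moreover have "w \<otimes>\<^bsub>completion\<^esub> inv\<^bsub>completion\<^esub> ?\<iota> (g i) \<in> H"
          using w(1) \<iota>H[OF gi] by simp
        ultimately have "w \<otimes>\<^bsub>?H\<^esub> inv\<^bsub>?H\<^esub> ?\<iota> (g i) \<in> ?N"
          using C.m_inv_consistent[OF sub, of "?\<iota> (g i)"] \<iota>H[OF gi] by (simp add: N)
        then have "?N #>\<^bsub>?H\<^esub> w = ?N #>\<^bsub>?H\<^esub> ?\<iota> (g i)"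
          using H.lower_central_coset_eq_iff w(1) \<iota>H[OF gi] by simp
        then have "M = ?f (\<gamma> i #> g i)" using w f[OF gi] by simp
        moreover have "\<gamma> i #> g i \<in> carrier (G Mod \<gamma> i)"
          using gi by (auto simp: FactGroup_def RCOSETS_def)
        ultimately show "M \<in> ?f ` carrier (G Mod \<gamma> i)" by blast
      qed
    qed
  qed
  with sub map show ?thesis
    by (simp add: parafree_subgroup_def Let_def)
qed

lemma commutator_closed_hull:
  assumes xs: "distinct xs" "set xs \<subseteq> carrier G" "generate G (set xs) = carrier G"
    and G: "countable (carrier G)" and A: "countable A" "A \<subseteq> carrier completion"
  obtains H where "countable H" "A \<subseteq> H" "commutator_closed_subgroup xs H"
proof -
  interpret C: group completion by (rule group_completion)
  interpret \<iota>: group_hom G completion "completion_map G" by (rule completion_map_hom)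
  have "\<forall>w n. \<exists>s. (\<forall>x. s x \<in> carrier completion) \<and>
      (n \<ge> 1 \<and> w \<in> carrier completion \<and> w (Suc n) = \<gamma> (Suc n) \<longrightarrow>
        (\<forall>x. s x n = \<gamma> n) \<and> w = commutator_prod completion s (completion_map G) xs)"
  proof (intro allI)
    fix w n
    show "\<exists>s. (\<forall>x. s x \<in> carrier completion) \<and>
      (n \<ge> 1 \<and> w \<in> carrier completion \<and> w (Suc n) = \<gamma> (Suc n) \<longrightarrow>
        (\<forall>x. s x n = \<gamma> n) \<and> w = commutator_prod completion s (completion_map G) xs)"
    proof (cases "n \<ge> 1 \<and> w \<in> carrier completion \<and> w (Suc n) = \<gamma> (Suc n)")
      case True
      then obtain s where "s \<in> UNIV \<rightarrow> {v \<in> carrier completion. v n = \<gamma> n}"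
        "w = commutator_prod completion s (completion_map G) xs"
        using completion_commutator_prod[OF _ xs] by blast
      then show ?thesis by (intro exI[of _ s]) auto
    next
      case False
      then show ?thesis using C.one_closed by blast
    qed
  qed
  then obtain \<sigma> where \<sigma>_carrier: "\<And>w n x. \<sigma> w n x \<in> carrier completion"
    and \<sigma>: "\<And>w n. n \<ge> 1 \<Longrightarrow> w \<in> carrier completion \<Longrightarrow> w (Suc n) = \<gamma> (Suc n) \<Longrightarrow>
      (\<forall>x. \<sigma> w n x n = \<gamma> n) \<and> w = commutator_prod completion (\<sigma> w n) (completion_map G) xs"
    by metis
  let ?ops = "{(\<lambda>a b. a \<otimes>\<^bsub>completion\<^esub> b), (\<lambda>a b. inv\<^bsub>completion\<^esub> a)} \<union>
    (\<lambda>(n, x) a b. \<sigma> a n x) ` (UNIV \<times> set xs)"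
  obtain H where H: "countable H" "A \<union> completion_map G ` carrier G \<subseteq> H" "H \<subseteq> carrier completion"
    and ops: "\<And>f a b. f \<in> ?ops \<Longrightarrow> a \<in> H \<Longrightarrow> b \<in> H \<Longrightarrow> f a b \<in> H"
  proof (rule countable_closure_binary)
    show "countable (A \<union> completion_map G ` carrier G)" using A G by simp
    show "countable ?ops" by (intro countable_Un countable_image countable_SIGMA) (auto intro: countable_finite)
    show "A \<union> completion_map G ` carrier G \<subseteq> carrier completion" using A by auto
    show "f a b \<in> carrier completion"
      if "f \<in> ?ops" "a \<in> carrier completion" "b \<in> carrier completion" for f a b
      using that \<sigma>_carrier by auto
  qed blast
  have "subgroup H completion"
  proof (rule C.subgroupI)
    show "H \<noteq> {}" using H(2) one_closed by blast
    show "inv\<^bsub>completion\<^esub> a \<in> H" if "a \<in> H" for a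
      using ops[of "\<lambda>a b. inv\<^bsub>completion\<^esub> a" a a] that by simp
    show "a \<otimes>\<^bsub>completion\<^esub> b \<in> H" if "a \<in> H" "b \<in> H" for a b
      using ops[of "\<lambda>a b. a \<otimes>\<^bsub>completion\<^esub> b" a b] that by simp
  qed (rule H)
  moreover have "\<sigma> w n x \<in> H" if "w \<in> H" "x \<in> set xs" for w n x
  proof -
    have "(\<lambda>a b. \<sigma> a n x) \<in> ?ops"
      using that by (intro UnI2 image_eqI[of _ _ "(n, x)"]) auto
    from ops[OF this that(1) that(1)] show ?thesis .
  qed
  moreover have "\<exists>s. (\<forall>x\<in>set xs. s x \<in> H \<and> s x n = \<gamma> n) \<and>
      w = commutator_prod completion s (completion_map G) xs"
    if "n \<ge> 1" "w \<in> H" "w (Suc n) = \<gamma> (Suc n)" for n w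
    using \<sigma>[of n w] that H(3) calculation(2) by (intro exI[of _ "\<sigma> w n"]) auto
  moreover have "completion_map G ` carrier G \<subseteq> H" using H(2) by simp
  ultimately have "commutator_closed_subgroup xs H"
    unfolding commutator_closed_subgroup_def by simp
  with H show thesis by (intro that[of H]) auto
qed

end

section \<open>A nonvanishing criterion for the second homology\<close>

lemma bar_boundary_2_of:
  "bar_boundary G 2 (frag_of [g, h]) = frag_of [h] - frag_of [g \<otimes>\<^bsub>G\<^esub> h] + frag_of [g]"
  by (simp add: bar_boundary_def bar_face_def atMost_Suc numeral_2_eq_2)

lemma bar_boundary_3_of:
  "bar_boundary G 3 (frag_of [g, h, k]) =
    frag_of [h, k] - frag_of [g \<otimes>\<^bsub>G\<^esub> h, k] + frag_of [g, h \<otimes>\<^bsub>G\<^esub> k] - frag_of [g, h]"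
  by (simp add: bar_boundary_def bar_face_def atMost_Suc numeral_3_eq_3)

lemma bar_boundary_add: "bar_boundary G n (c + d) = bar_boundary G n c + bar_boundary G n d"
  by (simp add: bar_boundary_def frag_extend_add)

lemma bar_boundary_diff: "bar_boundary G n (c - d) = bar_boundary G n c - bar_boundary G n d"
  by (simp add: bar_boundary_def frag_extend_diff)

definition cochain_eval :: "('a \<Rightarrow> 'a \<Rightarrow> rat) \<Rightarrow> ('a list \<Rightarrow>\<^sub>0 int) \<Rightarrow> rat"
  where "cochain_eval \<theta> c = (\<Sum>gs. of_int (Poly_Mapping.lookup c gs) * \<theta> (gs ! 0) (gs ! 1))"

lemma cochain_eval_of [simp]: "cochain_eval \<theta> (frag_of [g, h]) = \<theta> g h"
proof -
  have "cochain_eval \<theta> (frag_of [g, h]) = (\<Sum>gs. (if gs = [g, h] then \<theta> g h else 0))"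
    unfolding cochain_eval_def by (intro Sum_any.cong) (auto simp: lookup_single when_def)
  then show ?thesis by simp
qed

lemma cochain_eval_add: "cochain_eval \<theta> (c + d) = cochain_eval \<theta> c + cochain_eval \<theta> d"
proof -
  have fin: "finite {gs. of_int (Poly_Mapping.lookup e gs) * \<theta> (gs ! 0) (gs ! 1) \<noteq> 0}" for e
    by (rule finite_subset[OF _ finite_lookup[of e]]) auto
  show ?thesis
    unfolding cochain_eval_def Sum_any.distrib[OF fin fin, symmetric]
    by (simp add: lookup_add distrib_right)
qed

lemma cochain_eval_diff: "cochain_eval \<theta> (c - d) = cochain_eval \<theta> c - cochain_eval \<theta> d"
  using cochain_eval_add[of \<theta> "c - d" d] by simp

text \<open>For a cocycle \<open>\<theta>\<close>, this describes which elements \<open>(-r, g)\<close> of the central extension of \<open>G\<close> by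
  \<open>\<rat>\<close> with cocycle \<open>\<theta>\<close> are products of commutators; hence the rules for products and commutators
  below.\<close>

definition bounds ::
    "('a, 'b) monoid_scheme \<Rightarrow> ('a \<Rightarrow> 'a \<Rightarrow> rat) \<Rightarrow> 'a \<Rightarrow> rat \<Rightarrow> bool"
  where "bounds G \<theta> g r \<longleftrightarrow>
    (\<exists>c\<in>carrier (bar_chains G 2). bar_boundary G 2 c = frag_of [g] \<and> cochain_eval \<theta> c = r)"

lemma bar_chains_2_of [simp]:
  "g \<in> carrier G \<Longrightarrow> h \<in> carrier G \<Longrightarrow> frag_of [g, h] \<in> carrier (bar_chains G 2)"
  by (simp add: bar_chains_def carrier_free_Abelian_group_iff)

lemma bar_chains_add:
  "c \<in> carrier (bar_chains G n) \<Longrightarrow> d \<in> carrier (bar_chains G n) \<Longrightarrow> c + d \<in> carrier (bar_chains G n)"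
  using keys_add[of c d] by (simp add: bar_chains_def carrier_free_Abelian_group_iff) blast

lemma bar_chains_diff:
  "c \<in> carrier (bar_chains G n) \<Longrightarrow> d \<in> carrier (bar_chains G n) \<Longrightarrow> c - d \<in> carrier (bar_chains G n)"
  using keys_diff[of c d] by (simp add: bar_chains_def carrier_free_Abelian_group_iff) blast

context group
begin

lemma bounds_one: "bounds G \<theta> \<one> (\<theta> \<one> \<one>)"
  unfolding bounds_def by (intro bexI[of _ "frag_of [\<one>, \<one>]"]) (auto simp: bar_boundary_2_of)

lemma bounds_mult:
  assumes "bounds G \<theta> g r" "bounds G \<theta> h s" "g \<in> carrier G" "h \<in> carrier G"
  shows "bounds G \<theta> (g \<otimes> h) (r + s - \<theta> g h)"
proof -
  obtain c d where "c \<in> carrier (bar_chains G 2)" "bar_boundary G 2 c = frag_of [g]" "cochain_eval \<theta> c = r"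
    and "d \<in> carrier (bar_chains G 2)" "bar_boundary G 2 d = frag_of [h]" "cochain_eval \<theta> d = s"
    using assms by (auto simp: bounds_def)
  with assms show ?thesis
    unfolding bounds_def
    by (intro bexI[of _ "c + d - frag_of [g, h]"] bar_chains_add bar_chains_diff)
      (auto simp: bar_boundary_add bar_boundary_diff bar_boundary_2_of cochain_eval_add cochain_eval_diff)
qed

lemma bounds_commutator:
  assumes "x \<in> carrier G" "y \<in> carrier G"
  shows "bounds G \<theta> (commutator G x y) (\<theta> (commutator G x y) (y \<otimes> x) - \<theta> x y + \<theta> y x)"
proof -
  note commutator_mult_swap[OF assms]
  with assms show ?thesis
    unfolding bounds_def
    by (intro bexI[of _ "frag_of [commutator G x y, y \<otimes> x] - frag_of [x, y] + frag_of [y, x]"]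
        bar_chains_add bar_chains_diff)
      (auto simp: bar_boundary_add bar_boundary_diff bar_boundary_2_of cochain_eval_add cochain_eval_diff)
qed

lemma cocycle_vanishes_on_boundaries:
  assumes cocycle: "\<And>g h k. \<lbrakk>g \<in> carrier G; h \<in> carrier G; k \<in> carrier G\<rbrakk> \<Longrightarrow>
      \<theta> h k - \<theta> (g \<otimes> h) k + \<theta> g (h \<otimes> k) - \<theta> g h = 0"
    and c: "c \<in> carrier (bar_chains G 3)"
  shows "cochain_eval \<theta> (bar_boundary G 3 c) = 0"
proof -
  have "Poly_Mapping.keys c \<subseteq> {gs. length gs = 3 \<and> set gs \<subseteq> carrier G}"
    using c by (simp add: bar_chains_def carrier_free_Abelian_group_iff)
  then show ?thesis
  proof (induction rule: frag_induction)
    case zero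
    show ?case
      using bar_boundary_diff[of G 3 0 0] cochain_eval_diff[of \<theta> 0 0] by simp
  next
    case (one gs)
    then obtain g h k where "gs = [g, h, k]" "g \<in> carrier G" "h \<in> carrier G" "k \<in> carrier G"
      by (auto simp: length_Suc_conv numeral_3_eq_3)
    with cocycle[of g h k] show ?case
      by (simp add: bar_boundary_3_of cochain_eval_add cochain_eval_diff)
  next
    case (diff a b)
    then show ?case by (simp add: bar_boundary_diff cochain_eval_diff)
  qed
qed

text \<open>The difference of the two 2-chains bounded by \<open>[g]\<close> is a 2-cycle with \<open>\<theta>\<close>-value \<open>r - s\<close>.\<close>

lemma homology_2_nontrivial:
  assumes cocycle: "\<And>g h k. \<lbrakk>g \<in> carrier G; h \<in> carrier G; k \<in> carrier G\<rbrakk> \<Longrightarrow>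
      \<theta> h k - \<theta> (g \<otimes> h) k + \<theta> g (h \<otimes> k) - \<theta> g h = 0"
    and bounds: "bounds G \<theta> g r" "bounds G \<theta> g s" and "r \<noteq> s"
  shows "\<not> trivial_group (group_homology 2 G)"
proof
  assume "trivial_group (group_homology 2 G)"
  then have triv: "carrier (group_homology 2 G) = {\<one>\<^bsub>group_homology 2 G\<^esub>}"
    by (simp add: trivial_group_def)
  obtain c d where c: "c \<in> carrier (bar_chains G 2)" "bar_boundary G 2 c = frag_of [g]" "cochain_eval \<theta> c = r"
    and d: "d \<in> carrier (bar_chains G 2)" "bar_boundary G 2 d = frag_of [g]" "cochain_eval \<theta> d = s"
    using bounds by (auto simp: bounds_def)
  let ?Z = "kernel (bar_chains G 2) (bar_chains G 1) (bar_boundary G 2)"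
  let ?B = "bar_boundary G 3 ` carrier (bar_chains G 3)"
  let ?K = "(bar_chains G 2)\<lparr>carrier := ?Z\<rparr>"
  have H: "group_homology 2 G = ?K Mod ?B"
    by (simp add: group_homology_def numeral_3_eq_3 numeral_2_eq_2)
  have z: "c - d \<in> ?Z"
    using c d bar_chains_diff[of c G 2 d] by (simp add: kernel_def bar_boundary_diff) (simp add: bar_chains_def)
  then have "?B #>\<^bsub>?K\<^esub> (c - d) \<in> carrier (group_homology 2 G)"
    unfolding H by (auto simp: FactGroup_def RCOSETS_def)
  then have "?B #>\<^bsub>?K\<^esub> (c - d) = ?B"
    unfolding triv by (simp add: H FactGroup_def)
  moreover have "c - d \<in> ?B #>\<^bsub>?K\<^esub> (c - d)"
  proof -
    have "0 \<in> carrier (bar_chains G 3)" "bar_boundary G 3 0 = 0"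
      using bar_boundary_diff[of G 3 0 0] by (auto simp: bar_chains_def carrier_free_Abelian_group_iff)
    then have "0 \<in> ?B" by force
    then show ?thesis by (force simp: r_coset_def bar_chains_def)
  qed
  ultimately obtain e where "e \<in> carrier (bar_chains G 3)" "c - d = bar_boundary G 3 e" by auto
  then have "cochain_eval \<theta> (c - d) = 0"
    using cocycle_vanishes_on_boundaries[OF cocycle] by metis
  with c d \<open>r \<noteq> s\<close> show False by (simp add: cochain_eval_diff)
qed

end

subsection \<open>Crossed homomorphisms\<close>

definition crossed_hom :: "('a, 'b) monoid_scheme \<Rightarrow> ('a \<Rightarrow> rat) \<Rightarrow> ('a \<Rightarrow> rat) \<Rightarrow> bool"
  where "crossed_hom G \<epsilon> l \<longleftrightarrow>
    (\<forall>g\<in>carrier G. \<forall>h\<in>carrier G. l (g \<otimes>\<^bsub>G\<^esub> h) = l g + \<epsilon> g * l h)"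

definition sign_character :: "('a, 'b) monoid_scheme \<Rightarrow> ('a \<Rightarrow> rat) \<Rightarrow> bool"
  where "sign_character G \<epsilon> \<longleftrightarrow>
    (\<forall>g\<in>carrier G. \<epsilon> g * \<epsilon> g = 1) \<and>
    (\<forall>g\<in>carrier G. \<forall>h\<in>carrier G. \<epsilon> (g \<otimes>\<^bsub>G\<^esub> h) = \<epsilon> g * \<epsilon> h)"

context group
begin

lemma sign_character_commutator:
  assumes "sign_character G \<epsilon>" "x \<in> carrier G" "y \<in> carrier G"
  shows "\<epsilon> (commutator G x y) = 1"
proof -
  have mult: "\<epsilon> (g \<otimes> h) = \<epsilon> g * \<epsilon> h" and sq: "\<epsilon> g * \<epsilon> g = 1"
    if "g \<in> carrier G" "h \<in> carrier G" for g h
    using assms that by (auto simp: sign_character_def)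
  have "\<epsilon> (commutator G x y) * (\<epsilon> y * \<epsilon> x) = \<epsilon> x * \<epsilon> y"
    using mult[of "commutator G x y" "y \<otimes> x"] mult[of y x] mult[of x y] assms
    by (auto simp add: commutator_mult_swap)
  moreover have "\<epsilon> x \<noteq> 0" "\<epsilon> y \<noteq> 0"
    using sq assms by fastforce+
  ultimately show ?thesis by simp
qed

lemma crossed_hom_commutator:
  assumes "sign_character G \<epsilon>" "crossed_hom G \<epsilon> l" "x \<in> carrier G" "y \<in> carrier G"
  shows "l (commutator G x y) = (1 - \<epsilon> y) * l x - (1 - \<epsilon> x) * l y"
proof -
  have mult: "l (g \<otimes> h) = l g + \<epsilon> g * l h" if "g \<in> carrier G" "h \<in> carrier G" for g h
    using assms that by (auto simp: crossed_hom_def)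
  have "l (commutator G x y) + \<epsilon> (commutator G x y) * l (y \<otimes> x) = l (x \<otimes> y)"
    using mult[of "commutator G x y" "y \<otimes> x"] assms by (simp add: commutator_mult_swap)
  with assms show ?thesis
    by (simp add: sign_character_commutator mult algebra_simps)
qed

text \<open>The cup product of two derivations takes values in the tensor square of the sign
  representation, which is trivial because \<open>\<epsilon>\<^sup>2 = 1\<close>.\<close>

lemma cup_product_cocycle:
  assumes "sign_character G \<epsilon>" "crossed_hom G \<epsilon> l" "crossed_hom G \<epsilon> m"
    and "g \<in> carrier G" "h \<in> carrier G" "k \<in> carrier G"
  defines "\<theta> \<equiv> \<lambda>g h. l g * (\<epsilon> g * m h)"
  shows "\<theta> h k - \<theta> (g \<otimes> h) k + \<theta> g (h \<otimes> k) - \<theta> g h = 0"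
proof -
  have "l (g \<otimes> h) = l g + \<epsilon> g * l h" "m (h \<otimes> k) = m h + \<epsilon> h * m k"
    "\<epsilon> (g \<otimes> h) = \<epsilon> g * \<epsilon> h" "\<epsilon> g * \<epsilon> g = 1"
    using assms by (auto simp: crossed_hom_def sign_character_def)
  moreover from this have "\<theta> h k - \<theta> (g \<otimes> h) k + \<theta> g (h \<otimes> k) - \<theta> g h
      = (1 - \<epsilon> g * \<epsilon> g) * (l h * (\<epsilon> h * m k))"
    unfolding \<theta>_def by (simp add: algebra_simps)
  ultimately show ?thesis by simp
qed

text \<open>Two ways of writing the same element as a product of commutators give a 2-cycle. Only one of
  the \<open>e x\<close> acts nontrivially, so \<open>l\<close> vanishes on all factors \<open>[s x, e x]\<close> but one; since \<open>l\<close>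
  vanishes on \<open>[u, v]\<close>, it vanishes on the last one too. Thus the cup product of \<open>l\<close> and \<open>m\<close> does not
  see the product over \<open>xs\<close> at all, whereas its value on \<open>[u, v]\<close> is, up to sign, the determinant of
  \<open>l\<close> and \<open>m\<close> at \<open>u, v\<close>.\<close>

theorem homology_2_nontrivial_of_crossed_homs:
  assumes \<epsilon>: "sign_character G \<epsilon>" and l: "crossed_hom G \<epsilon> l" and m: "crossed_hom G \<epsilon> m"
    and u: "u \<in> carrier G" "\<epsilon> u = 1" and v: "v \<in> carrier G" "\<epsilon> v = 1"
    and s: "s \<in> set xs \<rightarrow> carrier G" and e: "e \<in> set xs \<rightarrow> carrier G"
    and uv: "commutator G u v = commutator_prod G s e xs"
    and vanish: "\<And>x. x \<in> set xs \<Longrightarrow> l (e x) = 0 \<and> m (e x) = 0"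
    and a: "a \<in> set xs" "distinct xs" "\<epsilon> (e a) = -1" "\<And>x. x \<in> set xs \<Longrightarrow> x \<noteq> a \<Longrightarrow> \<epsilon> (e x) = 1"
    and det: "l u * m v - l v * m u \<noteq> 0"
  shows "\<not> trivial_group (group_homology 2 G)"
proof (rule homology_2_nontrivial)
  define \<theta> where "\<theta> = (\<lambda>g h. l g * (\<epsilon> g * m h))"
  show "\<theta> h k - \<theta> (g \<otimes> h) k + \<theta> g (h \<otimes> k) - \<theta> g h = 0"
    if "g \<in> carrier G" "h \<in> carrier G" "k \<in> carrier G" for g h k
    unfolding \<theta>_def by (rule cup_product_cocycle[OF \<epsilon> l m that])
  have l_mult: "l (g \<otimes> h) = l g + \<epsilon> g * l h" if "g \<in> carrier G" "h \<in> carrier G" for g h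
    using l that by (auto simp: crossed_hom_def)
  have l_one: "l \<one> = 0"
    using crossed_hom_commutator[OF \<epsilon> l, of \<one> \<one>] by simp
  have luv: "l (commutator G u v) = 0"
    using crossed_hom_commutator[OF \<epsilon> l, of u v] u v by simp
  have factor: "l (commutator G (s x) (e x)) = (1 - \<epsilon> (e x)) * l (s x)" if "x \<in> set xs" for x
    using crossed_hom_commutator[OF \<epsilon> l, of "s x" "e x"] that s e vanish by (auto simp: Pi_iff)
  have sum: "l (commutator_prod G s e ys) = (\<Sum>x\<leftarrow>ys. (1 - \<epsilon> (e x)) * l (s x))"
    if "set ys \<subseteq> set xs" for ys
    using that
  proof (induction ys)
    case (Cons x ys)
    then have "commutator_prod G s e ys \<in> carrier G" "s x \<in> carrier G" "e x \<in> carrier G"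
      using s e by (auto intro!: commutator_prod_closed)
    with Cons factor show ?case
      by (simp add: l_mult sign_character_commutator[OF \<epsilon>])
  qed (simp add: l_one)
  have "(\<Sum>x\<leftarrow>xs. (1 - \<epsilon> (e x)) * l (s x)) = (\<Sum>x\<in>set xs. (1 - \<epsilon> (e x)) * l (s x))"
    using a(2) by (simp add: sum_list_distinct_conv_sum_set)
  also have "\<dots> = (\<Sum>x\<in>{a}. (1 - \<epsilon> (e x)) * l (s x))"
    using a by (intro sum.mono_neutral_right) auto
  finally have "l (s a) = 0"
    using luv sum[of xs] uv a(3) by simp
  then have l0: "l (commutator G (s x) (e x)) = 0" if "x \<in> set xs" for x
    using factor[OF that] a(4)[OF that] by (cases "x = a") auto
  have "bounds G \<theta> (commutator_prod G s e ys) 0" if "set ys \<subseteq> set xs" for ys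
    using that
  proof (induction ys)
    case Nil
    show ?case using bounds_one[of \<theta>] by (simp add: \<theta>_def l_one)
  next
    case (Cons x ys)
    then have c: "commutator_prod G s e ys \<in> carrier G" "s x \<in> carrier G" "e x \<in> carrier G"
      and x: "x \<in> set xs"
      using s e by (auto intro!: commutator_prod_closed)
    have "bounds G \<theta> (commutator G (s x) (e x)) 0"
      using bounds_commutator[of "s x" "e x" \<theta>] c l0[OF x] vanish[OF x] by (simp add: \<theta>_def)
    then show ?case
      using bounds_mult[of \<theta> "commutator G (s x) (e x)" 0 "commutator_prod G s e ys" 0] Cons c l0[OF x]
      by (simp add: \<theta>_def)
  qed
  from this[of xs] show "bounds G \<theta> (commutator G u v) 0" by (simp add: uv)
  show "bounds G \<theta> (commutator G u v) (- (l u * m v) + l v * m u)"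
    using bounds_commutator[of u v \<theta>] u v luv by (simp add: \<theta>_def)
  show "0 \<noteq> - (l u * m v) + l v * m u"
    using det by simp
qed

end

section \<open>Homomorphisms from a free group\<close>

lemma word_val_Nil [simp]: "word_val G [] = \<one>\<^bsub>G\<^esub>"
  by (simp add: word_val_def)

lemma word_val_Cons [simp]: "word_val G (l # w) = letter_val G l \<otimes>\<^bsub>G\<^esub> word_val G w"
  by (simp add: word_val_def)

context group
begin

lemma letter_val_closed: "fst l \<in> carrier G \<Longrightarrow> letter_val G l \<in> carrier G"
  by (simp add: letter_val_def)

lemma word_val_closed: "fst ` set w \<subseteq> carrier G \<Longrightarrow> word_val G w \<in> carrier G"
  by (induction w) (auto simp: letter_val_closed)

lemma word_val_append:
  "fst ` set v \<subseteq> carrier G \<Longrightarrow> fst ` set w \<subseteq> carrier G \<Longrightarrow>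
    word_val G (v @ w) = word_val G v \<otimes> word_val G w"
  by (induction v) (auto simp: letter_val_closed word_val_closed m_assoc)

lemma word_val_generate: "S \<subseteq> carrier G \<Longrightarrow> fst ` set w \<subseteq> S \<Longrightarrow> word_val G w \<in> generate G S"
proof (induction w)
  case (Cons l w)
  then have "letter_val G l \<in> generate G S"
    by (auto simp: letter_val_def intro: generate.incl generate.inv)
  with Cons show ?case by (auto intro: generate.eng)
qed (simp add: generate.one)

end

fun reduce_Cons :: "'a \<times> bool \<Rightarrow> ('a \<times> bool) list \<Rightarrow> ('a \<times> bool) list"
  where
    "reduce_Cons l [] = [l]"
  | "reduce_Cons l (m # w) = (if fst l = fst m \<and> snd l \<noteq> snd m then w else l # m # w)"

definition reduce :: "('a \<times> bool) list \<Rightarrow> ('a \<times> bool) list"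
  where "reduce w = foldr reduce_Cons w []"

lemma reduce_reduced:
  assumes "set w \<subseteq> S \<times> UNIV"
  shows "reduce w \<in> reduced_words S"
proof -
  have reduce_Cons: "reduce_Cons l v \<in> reduced_words S" if "l \<in> S \<times> UNIV" "v \<in> reduced_words S" for l v
    using that by (cases v) (auto simp: reduced_words_def successively_Cons split: if_splits)
  show ?thesis
    using assms
  proof (induction w)
    case (Cons l w)
    then show ?case using reduce_Cons[of l "reduce w"] by (simp add: reduce_def)
  qed (simp add: reduce_def reduced_words_def)
qed

lemma (in group) word_val_reduce:
  assumes "f ` S \<subseteq> carrier G" "set w \<subseteq> S \<times> UNIV"
  shows "word_val G (map (apfst f) (reduce w)) = word_val G (map (apfst f) w)"
proof -
  have f: "f x \<in> carrier G" if "x \<in> S" for x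
    using that assms(1) by blast
  have reduce_Cons: "word_val G (map (apfst f) (reduce_Cons l v)) = word_val G (map (apfst f) (l # v))"
    if "set (l # v) \<subseteq> S \<times> UNIV" for l v
  proof (cases v)
    case (Cons m v')
    have letters: "fst l \<in> S" "fst m \<in> S" "\<And>k. k \<in> set v' \<Longrightarrow> fst k \<in> S"
      using that by (auto simp: Cons)
    have "word_val G (map (apfst f) v') \<in> carrier G"
      by (rule word_val_closed) (simp add: image_image image_subset_iff letters f)
    then have closed: "f (fst l) \<in> carrier G" "f (fst m) \<in> carrier G"
      "word_val G (map (apfst f) v') \<in> carrier G"
      using letters f by simp_all
    show ?thesis
    proof (cases "fst l = fst m \<and> snd l \<noteq> snd m")
      case True
      then show ?thesis using closed by (cases "snd m") (simp_all add: Cons letter_val_def)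
    next
      case False
      then have "reduce_Cons l v = l # v" by (simp only: Cons reduce_Cons.simps if_False)
      then show ?thesis by simp
    qed
  qed simp
  show ?thesis
    using assms(2)
  proof (induction w)
    case (Cons l w)
    have "set (l # reduce w) \<subseteq> S \<times> UNIV"
      using reduce_reduced[of w S] Cons.prems by (auto simp: reduced_words_def)
    from reduce_Cons[OF this] show ?case
      using Cons.IH Cons.prems by (simp add: reduce_def)
  qed (simp add: reduce_def)
qed

text \<open>Evaluating the reduced word of an element is multiplicative, because reducing a concatenation
  does not change its value.\<close>

theorem free_group_extend:
  assumes F: "free_group_on F S" and H: "group H" and f: "f ` S \<subseteq> carrier H"
  obtains \<phi> where "\<phi> \<in> hom F H" "\<And>x. x \<in> S \<Longrightarrow> \<phi> x = f x"
proof -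
  interpret F: group F using F by (simp add: free_group_on_def)
  interpret H: group H by (rule H)
  have S: "S \<subseteq> carrier F" and bij: "bij_betw (word_val F) (reduced_words S) (carrier F)"
    using F by (auto simp: free_group_on_def)
  define word where "word = inv_into (reduced_words S) (word_val F)"
  define eval where "eval w = word_val H (map (apfst f) w)" for w
  have word: "word g \<in> reduced_words S" "word_val F (word g) = g" if "g \<in> carrier F" for g
    using that bij by (auto simp: word_def bij_betw_def inv_into_into f_inv_into_f)
  have letters: "set (word g) \<subseteq> S \<times> UNIV" if "g \<in> carrier F" for g
    using word(1)[OF that] by (simp add: reduced_words_def)
  have eval_word: "eval (word (word_val F w)) = eval w" if w: "set w \<subseteq> S \<times> UNIV" for w
  proof -
    have "word_val F (reduce w) = word_val F w"
      using F.word_val_reduce[of "\<lambda>x. x" S w] S w by (simp add: apfst_def map_prod.id flip: id_def)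
    moreover have "word (word_val F (reduce w)) = reduce w"
      using reduce_reduced[OF w] bij by (simp add: word_def bij_betw_def)
    ultimately show ?thesis
      using H.word_val_reduce[OF f w] by (simp add: eval_def)
  qed
  have fst_letters: "fst ` set (map (apfst f) w) \<subseteq> carrier H" if "set w \<subseteq> S \<times> UNIV" for w
  proof -
    have "f (fst k) \<in> carrier H" if "k \<in> set w" for k
    proof -
      have "fst k \<in> S" using \<open>set w \<subseteq> S \<times> UNIV\<close> that by auto
      then show ?thesis using f by blast
    qed
    then show ?thesis by (simp add: image_image image_subset_iff)
  qed
  have eval_closed: "eval w \<in> carrier H" if "set w \<subseteq> S \<times> UNIV" for w
    unfolding eval_def using fst_letters[OF that] by (rule H.word_val_closed)
  show thesis
  proof (rule that[of "\<lambda>g. eval (word g)"])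
    show "(\<lambda>g. eval (word g)) \<in> hom F H"
    proof (rule homI)
      show "eval (word g) \<in> carrier H" if "g \<in> carrier F" for g
        using letters[OF that] by (rule eval_closed)
      fix g h assume g: "g \<in> carrier F" and h: "h \<in> carrier F"
      let ?w = "word g @ word h"
      have "fst ` set (word g) \<subseteq> carrier F" "fst ` set (word h) \<subseteq> carrier F"
        using letters[OF g] letters[OF h] S by auto
      then have "word_val F ?w = g \<otimes>\<^bsub>F\<^esub> h"
        using word g h by (simp add: F.word_val_append)
      then have "eval (word (g \<otimes>\<^bsub>F\<^esub> h)) = eval ?w"
        using eval_word[of ?w] letters g h by simp
      also have "\<dots> = eval (word g) \<otimes>\<^bsub>H\<^esub> eval (word h)"
        unfolding eval_def map_append
        using fst_letters[OF letters[OF g]] fst_letters[OF letters[OF h]] by (rule H.word_val_append)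
      finally show "eval (word (g \<otimes>\<^bsub>F\<^esub> h)) = eval (word g) \<otimes>\<^bsub>H\<^esub> eval (word h)" .
    qed
    fix x assume x: "x \<in> S"
    then have "word_val F [(x, True)] = x" and "f x \<in> carrier H"
      using S f by (auto simp: letter_val_def)
    then show "eval (word x) = f x"
      using eval_word[of "[(x, True)]"] x by (simp add: eval_def letter_val_def)
  qed
qed

lemma free_group_generate:
  assumes "free_group_on F S"
  shows "generate F S = carrier F"
proof -
  interpret F: group F using assms by (simp add: free_group_on_def)
  have S: "S \<subseteq> carrier F" and bij: "bij_betw (word_val F) (reduced_words S) (carrier F)"
    using assms by (auto simp: free_group_on_def)
  show ?thesis
  proof
    show "generate F S \<subseteq> carrier F" using S by (rule F.generate_incl)
    show "carrier F \<subseteq> generate F S"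
    proof
      fix g assume "g \<in> carrier F"
      then obtain w where "w \<in> reduced_words S" "g = word_val F w"
        using bij by (auto simp: bij_betw_def)
      then show "g \<in> generate F S"
        using S by (auto simp: reduced_words_def intro!: F.word_val_generate)
    qed
  qed
qed

lemma free_group_countable:
  assumes "free_group_on F S" "countable S"
  shows "countable (carrier F)"
proof -
  have "reduced_words S \<subseteq> lists (S \<times> UNIV)"
    by (auto simp: reduced_words_def)
  then have "countable (reduced_words S)"
    using assms(2) countable_subset by (metis countable_lists countable_SIGMA countableI_type)
  moreover have "carrier F = word_val F ` reduced_words S"
    using assms(1) by (simp add: free_group_on_def bij_betw_def)
  ultimately show ?thesis by simp
qed

section \<open>The infinite dihedral group\<close>

definition dihedral :: "(int \<times> int) monoid"
  where "dihedral = \<lparr>carrier = {1, -1} \<times> UNIV,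
    monoid.mult = (\<lambda>(e, m) (f, n). (e * f, m + e * n)), one = (1, 0)\<rparr>"

lemma group_dihedral: "group dihedral"
proof (rule groupI)
  fix x assume x: "x \<in> carrier dihedral"
  then show "\<exists>y\<in>carrier dihedral. y \<otimes>\<^bsub>dihedral\<^esub> x = \<one>\<^bsub>dihedral\<^esub>"
    by (intro bexI[of _ "(fst x, - fst x * snd x)"]) (auto simp: dihedral_def)
qed (auto simp: dihedral_def algebra_simps)

text \<open>The components of a homomorphism into the dihedral group: a sign character, and a derivation
  with respect to it.\<close>

locale dihedral_hom = group F for F (structure) +
  fixes eps psi :: "'a \<Rightarrow> int"
  assumes eps: "g \<in> carrier F \<Longrightarrow> eps g = 1 \<or> eps g = -1"
    and eps_mult: "g \<in> carrier F \<Longrightarrow> h \<in> carrier F \<Longrightarrow> eps (g \<otimes> h) = eps g * eps h"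
    and psi_mult: "g \<in> carrier F \<Longrightarrow> h \<in> carrier F \<Longrightarrow> psi (g \<otimes> h) = psi g + eps g * psi h"
begin

lemma eps_one [simp]: "eps \<one> = 1" and psi_one [simp]: "psi \<one> = 0"
  using eps[of \<one>] eps_mult[of \<one> \<one>] psi_mult[of \<one> \<one>] by auto

lemma eps_commutator:
  assumes "g \<in> carrier F" "h \<in> carrier F"
  shows "eps (commutator F g h) = 1"
  using eps_mult[of "commutator F g h" "h \<otimes> g"] eps_mult[of g h] eps_mult[of h g]
    eps[of g] eps[of h] assms
  by (auto simp: commutator_mult_swap)

lemma psi_commutator:
  assumes "g \<in> carrier F" "h \<in> carrier F"
  shows "psi (commutator F g h) = (1 - eps h) * psi g - (1 - eps g) * psi h"
  using psi_mult[of "commutator F g h" "h \<otimes> g"] psi_mult[of g h] psi_mult[of h g] eps_commutator assms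
  by (auto simp: commutator_mult_swap algebra_simps)

lemma eps_inv: "g \<in> carrier F \<Longrightarrow> eps (inv g) = eps g"
  using eps_mult[of "inv g" g] eps[of g] eps[of "inv g"] by auto

lemma psi_inv: "g \<in> carrier F \<Longrightarrow> psi (inv g) = - eps g * psi g"
  using psi_mult[of "inv g" g] eps_inv[of g] by auto

lemma even_one_minus_eps: "g \<in> carrier F \<Longrightarrow> 2 dvd 1 - eps g"
  using eps[of g] by auto

lemma generate_commutators_dihedral:
  assumes comm: "\<And>h k. h \<in> lower_central F (Suc n) \<Longrightarrow> k \<in> carrier F \<Longrightarrow>
      2 ^ Suc n dvd psi (commutator F h k)"
    and g: "g \<in> lower_central F (Suc (Suc n))"
  shows "eps g = 1 \<and> 2 ^ Suc n dvd psi g"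
proof -
  let ?gens = "{commutator F h k | h k. h \<in> lower_central F (Suc n) \<and> k \<in> carrier F}"
  have "g \<in> generate F ?gens" using g lower_central_Suc[of "Suc n"] by simp
  then show ?thesis
  proof (induction rule: generate.induct)
    case one
    then show ?case by simp
  next
    case (incl c)
    then show ?case using comm eps_commutator lower_central_carrier by blast
  next
    case (inv c)
    then have c: "c \<in> carrier F" "eps c = 1" "2 ^ Suc n dvd psi c"
      using comm eps_commutator lower_central_carrier commutator_closed by blast+
    then show ?case by (simp add: eps_inv psi_inv)
  next
    case (eng c d)
    have "?gens \<subseteq> carrier F" by (auto dest: lower_central_carrier)
    then have "c \<in> carrier F" "d \<in> carrier F"
      using eng generate_in_carrier by blast+
    with eng show ?case by (simp add: eps_mult psi_mult)
  qed
qed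

text \<open>The commutator of a translation with a reflection is twice the translation, so \<open>\<gamma>\<^sub>n\<^sub>+\<^sub>1\<close> of the
  dihedral group is \<open>2\<^sup>n\<int>\<close> for \<open>n \<ge> 1\<close>.\<close>

lemma lower_central_dihedral:
  assumes "g \<in> lower_central F (Suc (Suc n))"
  shows "eps g = 1 \<and> 2 ^ Suc n dvd psi g"
  using assms
proof (induction n arbitrary: g)
  case 0
  show ?case
  proof (rule generate_commutators_dihedral[OF _ 0])
    fix h k assume "h \<in> lower_central F (Suc 0)" "k \<in> carrier F"
    then show "2 ^ Suc 0 dvd psi (commutator F h k)"
      using even_one_minus_eps[of h] even_one_minus_eps[of k] by (simp add: psi_commutator)
  qed
next
  case (Suc n)
  show ?case
  proof (rule generate_commutators_dihedral[OF _ Suc.prems])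
    fix h k assume h: "h \<in> lower_central F (Suc (Suc n))" and k: "k \<in> carrier F"
    have "psi (commutator F h k) = (1 - eps k) * psi h"
      using Suc.IH[OF h] k lower_central_carrier[OF h] by (simp add: psi_commutator)
    moreover have "2 * 2 ^ Suc n dvd (1 - eps k) * psi h"
      using Suc.IH[OF h] even_one_minus_eps[OF k] by (intro mult_dvd_mono) auto
    ultimately show "2 ^ Suc (Suc n) dvd psi (commutator F h k)" by simp
  qed
qed

end

lemma free_group_dihedral_hom:
  assumes F: "free_group_on F S" and "e ` S \<subseteq> {1, -1}"
  obtains eps psi where "dihedral_hom F eps psi" "\<And>x. x \<in> S \<Longrightarrow> eps x = e x \<and> psi x = m x"
proof -
  have f: "(\<lambda>x. (e x, m x)) ` S \<subseteq> carrier dihedral" using assms(2) by (auto simp: dihedral_def)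
  obtain \<phi> where \<phi>: "\<phi> \<in> hom F dihedral" "\<And>x. x \<in> S \<Longrightarrow> \<phi> x = (e x, m x)"
    using free_group_extend[OF F group_dihedral f] by blast
  show thesis
  proof (rule that)
    show "dihedral_hom F (\<lambda>g. fst (\<phi> g)) (\<lambda>g. snd (\<phi> g))"
    proof (intro dihedral_hom.intro dihedral_hom_axioms.intro)
      show "group F" using F by (simp add: free_group_on_def)
      show "fst (\<phi> g) = 1 \<or> fst (\<phi> g) = - 1" if "g \<in> carrier F" for g
        using hom_in_carrier[OF \<phi>(1) that] by (auto simp: dihedral_def)
      fix g h assume "g \<in> carrier F" "h \<in> carrier F"
      then have "\<phi> (g \<otimes>\<^bsub>F\<^esub> h) = \<phi> g \<otimes>\<^bsub>dihedral\<^esub> \<phi> h" by (rule hom_mult[OF \<phi>(1)])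
      then show "fst (\<phi> (g \<otimes>\<^bsub>F\<^esub> h)) = fst (\<phi> g) * fst (\<phi> h)"
        "snd (\<phi> (g \<otimes>\<^bsub>F\<^esub> h)) = snd (\<phi> g) + fst (\<phi> g) * snd (\<phi> h)"
        by (simp_all add: dihedral_def split_beta)
    qed
    show "fst (\<phi> x) = e x \<and> snd (\<phi> x) = m x" if "x \<in> S" for x
      using \<phi>(2)[OF that] by simp
  qed
qed

section \<open>Functionals on the 2-adic integers\<close>

text \<open>A form of 2-adic convergence to 0. The common denominator \<open>N\<close> makes the null sequences closed
  under multiplication by rational numbers, so that they form a subspace.\<close>

definition null_2adic :: "(nat \<Rightarrow> rat) \<Rightarrow> bool"
  where "null_2adic q \<longleftrightarrow> (\<exists>N::int. N \<noteq> 0 \<and>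
    (\<forall>k. \<forall>\<^sub>F n in sequentially. \<exists>z::int. of_int N * q n = of_int (2 ^ k * z)))"

lemma null_2adic_scale:
  assumes "null_2adic q"
  shows "null_2adic (\<lambda>n. c * q n)"
proof -
  obtain N where N: "N \<noteq> 0"
    "\<And>k. \<forall>\<^sub>F n in sequentially. \<exists>z::int. of_int N * q n = of_int (2 ^ k * z)"
    using assms unfolding null_2adic_def by auto
  obtain a b where ab: "quotient_of c = (a, b)" by fastforce
  then have b: "b > 0" and c: "c = of_int a / of_int b"
    using quotient_of_denom_pos quotient_of_div by blast+
  have "\<forall>\<^sub>F n in sequentially. \<exists>z::int. of_int (N * b) * (c * q n) = of_int (2 ^ k * z)" for k
    using N(2)[of k]
  proof eventually_elim
    case (elim n)
    then obtain z :: int where z: "of_int N * q n = of_int (2 ^ k * z)" by blast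
    have "of_int (N * b) * (c * q n) = of_int a * (of_int N * q n)"
      using b by (simp add: c)
    also have "\<dots> = of_int (2 ^ k * (a * z))"
      unfolding z by simp
    finally show ?case by blast
  qed
  moreover have "N * b \<noteq> 0" using N b by simp
  ultimately show ?thesis unfolding null_2adic_def by blast
qed

lemma null_2adic_add:
  assumes "null_2adic p" "null_2adic q"
  shows "null_2adic (\<lambda>n. p n + q n)"
proof -
  obtain N where N: "N \<noteq> 0"
    "\<And>k. \<forall>\<^sub>F n in sequentially. \<exists>z::int. of_int N * p n = of_int (2 ^ k * z)"
    using assms(1) unfolding null_2adic_def by auto
  obtain M where M: "M \<noteq> 0"
    "\<And>k. \<forall>\<^sub>F n in sequentially. \<exists>z::int. of_int M * q n = of_int (2 ^ k * z)"
    using assms(2) unfolding null_2adic_def by auto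
  have "\<forall>\<^sub>F n in sequentially. \<exists>z::int. of_int (N * M) * (p n + q n) = of_int (2 ^ k * z)" for k
    using N(2)[of k] M(2)[of k]
  proof eventually_elim
    case (elim n)
    from elim(1) obtain y :: int where y: "of_int N * p n = of_int (2 ^ k * y)" by blast
    from elim(2) obtain z :: int where z: "of_int M * q n = of_int (2 ^ k * z)" by blast
    have "of_int (N * M) * (p n + q n) = of_int M * (of_int N * p n) + of_int N * (of_int M * q n)"
      by (simp add: algebra_simps)
    also have "\<dots> = of_int (2 ^ k * (M * y + N * z))"
      unfolding y z by (simp add: distrib_left mult_ac)
    finally show ?case by blast
  qed
  moreover have "N * M \<noteq> 0" using N M by simp
  ultimately show ?thesis unfolding null_2adic_def by blast
qed

lemma null_2adic_zero: "null_2adic (\<lambda>_. 0)"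
  unfolding null_2adic_def by (intro exI[of _ 1]) (auto intro: always_eventually exI[of _ 0])

text \<open>The divisor is \<open>2\<^sup>n\<^sup>-\<^sup>1\<close>, the index of \<open>\<gamma>\<^sub>n\<close> among the translations of the infinite dihedral group.\<close>

lemma null_2adic_of_int:
  fixes z :: "nat \<Rightarrow> int"
  assumes "\<And>n. n \<ge> n0 \<Longrightarrow> 2 ^ n dvd 2 * z n"
  shows "null_2adic (\<lambda>n. of_int (z n))"
proof -
  have "\<forall>\<^sub>F n in sequentially. \<exists>y::int. of_int 2 * (of_int (z n) :: rat) = of_int (2 ^ k * y)" for k
  proof (rule eventually_sequentiallyI)
    fix n assume n: "max n0 k \<le> n"
    then have "(2 ^ k :: int) dvd 2 ^ n" by (simp add: le_imp_power_dvd)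
    then have "2 ^ k dvd 2 * z n" using assms[of n] n dvd_trans by (metis max.bounded_iff)
    then obtain y where "2 * z n = 2 ^ k * y" by (elim dvdE)
    then have "of_int (2 * z n) = (of_int (2 ^ k * y) :: rat)" by simp
    then show "\<exists>y::int. of_int 2 * (of_int (z n) :: rat) = of_int (2 ^ k * y)" by auto
  qed
  then show ?thesis unfolding null_2adic_def by (intro exI[of _ 2]) auto
qed

definition digit_sums :: "nat set \<Rightarrow> nat \<Rightarrow> int"
  where "digit_sums D n = (\<Sum>i\<in>D \<inter> {..<n}. 2 ^ i)"

lemma digit_sums_simps [simp]:
  "digit_sums D 0 = 0"
  "digit_sums D (Suc n) = digit_sums D n + (if n \<in> D then 2 ^ n else 0)"
  by (simp_all add: digit_sums_def lessThan_Suc)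

lemma digit_sums_dvd: "m \<le> n \<Longrightarrow> 2 ^ m dvd digit_sums D n - digit_sums D m"
proof (induction n rule: dec_induct)
  case (step n)
  have "(2::int) ^ m dvd 2 ^ n" using step by (simp add: le_imp_power_dvd)
  with step have "2 ^ m dvd (digit_sums D n - digit_sums D m) + (if n \<in> D then 2 ^ n else 0)"
    by (intro dvd_add) auto
  then show ?case by (simp add: algebra_simps)
qed simp

text \<open>Two different sets of binary digits first differ at some place \<open>m\<close>, so the difference of the
  partial sums has 2-adic valuation exactly \<open>m\<close>.\<close>

lemma digit_sums_inj:
  assumes "null_2adic (\<lambda>n. of_int (digit_sums D n) - of_int (digit_sums E n))"
  shows "D = E"
proof (rule ccontr)
  assume "D \<noteq> E"
  then have "\<exists>m. (m \<in> D) \<noteq> (m \<in> E)" by auto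
  define m where "m = (LEAST m. (m \<in> D) \<noteq> (m \<in> E))"
  have m: "(m \<in> D) \<noteq> (m \<in> E)"
    unfolding m_def using \<open>\<exists>m. (m \<in> D) \<noteq> (m \<in> E)\<close> by (rule LeastI_ex)
  have "i \<in> D \<longleftrightarrow> i \<in> E" if "i < m" for i
    using not_less_Least[of i "\<lambda>m. (m \<in> D) \<noteq> (m \<in> E)"] that by (auto simp: m_def)
  then have eq: "digit_sums D m = digit_sums E m"
    unfolding digit_sums_def by (intro sum.cong) auto
  have val: "\<exists>y. digit_sums D n - digit_sums E n = 2 ^ m * (2 * y + 1)" if n: "n \<ge> Suc m" for n
  proof -
    obtain a b where a: "digit_sums D n - digit_sums D (Suc m) = 2 ^ Suc m * a"
      and b: "digit_sums E n - digit_sums E (Suc m) = 2 ^ Suc m * b"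
      using digit_sums_dvd[OF n] by (meson dvdE)
    have "digit_sums D n - digit_sums E n = 2 ^ Suc m * a - 2 ^ Suc m * b + (if m \<in> D then 2 ^ m else - (2 ^ m))"
      using a b eq m by (auto simp: algebra_simps)
    also have "\<dots> = 2 ^ m * (2 * (if m \<in> D then a - b else a - b - 1) + 1)"
      by (simp add: algebra_simps)
    finally show ?thesis by blast
  qed
  obtain N :: int where N: "N \<noteq> 0" and
    null: "\<And>k. \<forall>\<^sub>F n in sequentially. \<exists>z::int.
      of_int N * (of_int (digit_sums D n) - of_int (digit_sums E n) :: rat) = of_int (2 ^ k * z)"
    using assms unfolding null_2adic_def by auto
  define k where "k = m + nat \<bar>N\<bar>"
  from null[of k] obtain n0 where n0: "\<And>n. n \<ge> n0 \<Longrightarrow> \<exists>z::int.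
      of_int N * (of_int (digit_sums D n) - of_int (digit_sums E n) :: rat) = of_int (2 ^ k * z)"
    unfolding eventually_sequentially by blast
  define n where "n = max n0 (Suc m)"
  obtain z :: int where z: "of_int N * (of_int (digit_sums D n) - of_int (digit_sums E n) :: rat) = of_int (2 ^ k * z)"
    using n0[of n] by (auto simp: n_def)
  obtain y where y: "digit_sums D n - digit_sums E n = 2 ^ m * (2 * y + 1)"
    using val[of n] by (auto simp: n_def)
  have "of_int (N * (digit_sums D n - digit_sums E n)) = (of_int (2 ^ k * z) :: rat)"
    using z by simp
  then have "N * (digit_sums D n - digit_sums E n) = 2 ^ k * z"
    by (simp only: of_int_eq_iff)
  then have "2 ^ m * (N * (2 * y + 1)) = 2 ^ m * (2 ^ nat \<bar>N\<bar> * z)"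
    by (simp add: y k_def power_add mult_ac)
  then have "N * (2 * y + 1) = 2 ^ nat \<bar>N\<bar> * z" by simp
  then have "2 ^ nat \<bar>N\<bar> dvd N * (2 * y + 1)" by simp
  moreover have "coprime ((2::int) ^ nat \<bar>N\<bar>) (2 * y + 1)" by simp
  ultimately have "2 ^ nat \<bar>N\<bar> dvd N"
    by (simp add: coprime_dvd_mult_left_iff)
  then have "2 ^ nat \<bar>N\<bar> \<le> \<bar>N\<bar>"
    using dvd_imp_le_int[OF N, of "2 ^ nat \<bar>N\<bar>"] by simp
  moreover have "int (nat \<bar>N\<bar>) < int (2 ^ nat \<bar>N\<bar>)"
    by (simp only: of_nat_less_iff less_exp)
  then have "\<bar>N\<bar> < 2 ^ nat \<bar>N\<bar>" by simp
  ultimately show False by linarith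
qed

definition null_span :: "(nat \<Rightarrow> rat) \<Rightarrow> (nat \<Rightarrow> rat) set"
  where "null_span f = {q. \<exists>a b. null_2adic (\<lambda>n. q n - (a + b * f n))}"

lemma null_span_add:
  assumes "p \<in> null_span f" "q \<in> null_span f"
  shows "(\<lambda>n. p n + q n) \<in> null_span f"
proof -
  obtain a b where "null_2adic (\<lambda>n. p n - (a + b * f n))"
    using assms(1) by (auto simp: null_span_def)
  moreover obtain c d where "null_2adic (\<lambda>n. q n - (c + d * f n))"
    using assms(2) by (auto simp: null_span_def)
  ultimately have "null_2adic (\<lambda>n. p n - (a + b * f n) + (q n - (c + d * f n)))"
    by (rule null_2adic_add)
  also have "(\<lambda>n. p n - (a + b * f n) + (q n - (c + d * f n)))
      = (\<lambda>n. p n + q n - ((a + c) + (b + d) * f n))"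
    by (simp add: algebra_simps)
  finally show ?thesis unfolding null_span_def by blast
qed

lemma null_span_scale:
  assumes "q \<in> null_span f"
  shows "(\<lambda>n. c * q n) \<in> null_span f"
proof -
  obtain a b where "null_2adic (\<lambda>n. q n - (a + b * f n))"
    using assms by (auto simp: null_span_def)
  then have "null_2adic (\<lambda>n. c * (q n - (a + b * f n)))"
    by (rule null_2adic_scale)
  also have "(\<lambda>n. c * (q n - (a + b * f n))) = (\<lambda>n. c * q n - (c * a + (c * b) * f n))"
    by (simp add: algebra_simps)
  finally show ?thesis unfolding null_span_def by blast
qed

lemma null_2adic_in_null_span: "null_2adic q \<Longrightarrow> q \<in> null_span f"
proof -
  assume "null_2adic q"
  then have "null_2adic (\<lambda>n. q n - (0 + 0 * f n))" by simp
  then show ?thesis unfolding null_span_def by blast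
qed

lemma const_in_null_span: "(\<lambda>_. c) \<in> null_span f"
proof -
  have "null_2adic (\<lambda>n. c - (c + 0 * f n))" using null_2adic_zero by simp
  then show ?thesis unfolding null_span_def by blast
qed

lemma self_in_null_span: "f \<in> null_span f"
proof -
  have "null_2adic (\<lambda>n. f n - (0 + 1 * f n))" using null_2adic_zero by simp
  then show ?thesis unfolding null_span_def by blast
qed

lemma uncountable_nat_sets: "uncountable (UNIV :: nat set set)"
proof
  assume "countable (UNIV :: nat set set)"
  then have "range (from_nat_into (UNIV :: nat set set)) = UNIV"
    by (intro range_from_nat_into) auto
  then show False
    using Cantors_theorem[of "UNIV :: nat set"] by (metis Pow_UNIV)
qed

text \<open>Modulo null sequences the constants and \<open>f\<close> span a countable space, whereas there are
  uncountably many 2-adic integers.\<close>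

lemma digit_sums_notin_null_span: "\<exists>D. (\<lambda>n. of_int (digit_sums D n)) \<notin> null_span f"
proof (rule ccontr)
  assume "\<not> ?thesis"
  then have "\<forall>D. \<exists>c. null_2adic (\<lambda>n. of_int (digit_sums D n) - (fst c + snd c * f n))"
    by (simp add: null_span_def)
  then obtain c where c: "\<And>D. null_2adic (\<lambda>n. of_int (digit_sums D n) - (fst (c D) + snd (c D) * f n))"
    by metis
  have "inj c"
  proof (rule injI)
    fix D E assume "c D = c E"
    then have "null_2adic (\<lambda>n. of_int (digit_sums D n) - of_int (digit_sums E n))"
      using null_2adic_add[OF c[of D] null_2adic_scale[OF c[of E], of "-1"]] by (simp add: algebra_simps)
    then show "D = E" by (rule digit_sums_inj)
  qed
  then have "countable (UNIV :: nat set set)"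
    by (rule countableI') 
  with uncountable_nat_sets show False by contradiction
qed

definition seq_scale :: "rat \<Rightarrow> (nat \<Rightarrow> rat) \<Rightarrow> nat \<Rightarrow> rat"
  where "seq_scale c q = (\<lambda>n. c * q n)"

interpretation seq: vector_space seq_scale
  by unfold_locales (auto simp: seq_scale_def fun_eq_iff algebra_simps)

interpretation seq_rat: vector_space_pair seq_scale "(*) :: rat \<Rightarrow> rat \<Rightarrow> rat"
  by unfold_locales (auto simp: algebra_simps)

lemma null_span_subspace: "seq.subspace (null_span f)"
  using const_in_null_span[of 0 f] null_span_add[of _ f] null_span_scale[of _ f]
  by (intro seq.subspaceI) (auto simp: seq_scale_def zero_fun_def plus_fun_def)

lemma null_span_functional:
  assumes "x \<notin> null_span f"
  obtains L :: "(nat \<Rightarrow> rat) \<Rightarrow> rat" where "\<And>p q. L (\<lambda>n. p n + q n) = L p + L q"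
    "\<And>c q. L (\<lambda>n. c * q n) = c * L q" "\<And>q. q \<in> null_span f \<Longrightarrow> L q = 0" "L x = 1"
proof -
  obtain B where B: "B \<subseteq> null_span f" "seq.independent B" "null_span f \<subseteq> seq.span B"
    using seq.maximal_independent_subset[of "null_span f"] by blast
  have "seq.span B \<subseteq> null_span f"
    using B(1) null_span_subspace by (rule seq.span_minimal)
  then have "seq.independent (insert x B)"
    using assms B by (intro seq.independent_insertI) auto
  then obtain L where L: "Vector_Spaces.linear seq_scale (*) L"
    "\<And>y. y \<in> insert x B \<Longrightarrow> L y = (if y = x then 1 else 0)"
    using seq_rat.linear_independent_extend[of "insert x B" "\<lambda>y. if y = x then 1 else 0"] by blast
  interpret L: Vector_Spaces.linear seq_scale "(*)" L by (rule L(1))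
  show thesis
  proof (rule that)
    show "L (\<lambda>n. p n + q n) = L p + L q" for p q
      using L.add[of p q] by (simp add: plus_fun_def)
    show "L (\<lambda>n. c * q n) = c * L q" for c q
      using L.scale[of c q] by (simp add: seq_scale_def)
    show "L x = 1" using L(2)[of x] by simp
    show "L q = 0" if "q \<in> null_span f" for q
    proof -
      have "q \<in> seq.span B" using that B by auto
      then show ?thesis
      proof (rule L.eq_0_on_span[rotated])
        fix y assume "y \<in> B"
        then show "L y = 0" using L(2)[of y] assms B(1) by auto
      qed
    qed
  qed
qed

section \<open>Extending the dihedral homomorphism to the completion\<close>

text \<open>A linear functional on the space of rational sequences modulo null sequences. Such functionals
  serve as (discontinuous) functionals on the 2-adic integers, each of which is represented by
  sequences of integers.\<close>

definition null_functional :: "((nat \<Rightarrow> rat) \<Rightarrow> rat) \<Rightarrow> bool"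
  where "null_functional L \<longleftrightarrow> (\<forall>p q. L (\<lambda>n. p n + q n) = L p + L q) \<and>
    (\<forall>c q. L (\<lambda>n. c * q n) = c * L q) \<and> (\<forall>q. null_2adic q \<longrightarrow> L q = 0)"

lemma null_functional_cong:
  assumes "null_functional L" "null_2adic (\<lambda>n. p n - q n)"
  shows "L p = L q"
proof -
  have add: "L (\<lambda>n. r n + s n) = L r + L s" and null: "L (\<lambda>n. p n - q n) = 0" for r s
    using assms by (simp_all add: null_functional_def)
  show ?thesis using add[of "\<lambda>n. p n - q n" q] null by simp
qed

context dihedral_hom
begin

definition rep :: "(nat \<Rightarrow> 'a set) \<Rightarrow> nat \<Rightarrow> 'a"
  where "rep x = (SOME g. coherent F g \<and> x = coherent_lim F g)"

text \<open>The sign factors through the quotient by \<open>\<gamma>\<^sub>2\<close>, so that every index \<open>\<ge> 2\<close> gives the same value.\<close>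

definition eps_lim :: "(nat \<Rightarrow> 'a set) \<Rightarrow> rat"
  where "eps_lim x = of_int (eps (rep x 2))"

definition psi_lim :: "((nat \<Rightarrow> rat) \<Rightarrow> rat) \<Rightarrow> (nat \<Rightarrow> 'a set) \<Rightarrow> rat"
  where "psi_lim L x = L (\<lambda>n. of_int (psi (rep x n)))"

lemma rep:
  assumes "coherent F g"
  shows "coherent F (rep (coherent_lim F g))" "coherent_lim F (rep (coherent_lim F g)) = coherent_lim F g"
proof -
  have "coherent F (rep (coherent_lim F g)) \<and> coherent_lim F g = coherent_lim F (rep (coherent_lim F g))"
    unfolding rep_def by (rule someI[of _ g]) (use assms in simp)
  then show "coherent F (rep (coherent_lim F g))" "coherent_lim F (rep (coherent_lim F g)) = coherent_lim F g"
    by auto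
qed

lemma coset_eq_dihedral:
  assumes "\<gamma> n #> g = \<gamma> n #> h" "g \<in> carrier F" "h \<in> carrier F" "n \<ge> 2"
  shows "eps g = eps h" "2 ^ n dvd 2 * (psi g - psi h)"
proof -
  define z where "z = g \<otimes> inv h"
  obtain k where k: "n = Suc (Suc k)" using assms(4) by (metis add_2_eq_Suc le_Suc_ex)
  have "z \<in> \<gamma> n" using assms lower_central_coset_eq_iff unfolding z_def by blast
  then have z: "eps z = 1" "2 ^ Suc k dvd psi z"
    using lower_central_dihedral[of z k] k by auto
  have g: "g = z \<otimes> h" "z \<in> carrier F" using assms by (simp_all add: z_def m_assoc)
  then show "eps g = eps h" using z assms eps_mult[of z h] by simp
  have "psi g - psi h = psi z" using g z assms psi_mult[of z h] by simp
  moreover have "2 * 2 ^ Suc k dvd 2 * psi z" using z(2) by (rule mult_dvd_mono[OF dvd_refl])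
  ultimately show "2 ^ n dvd 2 * (psi g - psi h)" using k by simp
qed

lemma coherent_lim_eq_dihedral:
  assumes "coherent F g" "coherent F h" "coherent_lim F g = coherent_lim F h"
  shows "eps (g 2) = eps (h 2)" "null_2adic (\<lambda>n. of_int (psi (g n)) - of_int (psi (h n)))"
proof -
  have eq: "\<gamma> n #> g n = \<gamma> n #> h n" if "n \<ge> 1" for n
    using that assms(3) by (metis coherent_lim_apply)
  note carr = coherent_carrier[OF assms(1)] coherent_carrier[OF assms(2)]
  show "eps (g 2) = eps (h 2)"
    using coset_eq_dihedral(1)[OF eq[of 2] carr] by simp
  have "null_2adic (\<lambda>n. of_int (psi (g n) - psi (h n)))"
    using coset_eq_dihedral(2)[OF eq carr] by (intro null_2adic_of_int[of 2]) auto
  then show "null_2adic (\<lambda>n. of_int (psi (g n)) - of_int (psi (h n)))" by simp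
qed

lemma eps_lim_coherent_lim: "coherent F g \<Longrightarrow> eps_lim (coherent_lim F g) = of_int (eps (g 2))"
  using coherent_lim_eq_dihedral(1)[OF rep(1) _ rep(2)] by (simp add: eps_lim_def)

lemma psi_lim_coherent_lim:
  assumes "null_functional L" "coherent F g"
  shows "psi_lim L (coherent_lim F g) = L (\<lambda>n. of_int (psi (g n)))"
  unfolding psi_lim_def
  using coherent_lim_eq_dihedral(2)[OF rep(1)[OF assms(2)] assms(2) rep(2)[OF assms(2)]]
  by (rule null_functional_cong[OF assms(1)])

lemma eps_coherent:
  assumes "coherent F g" "n \<ge> 2"
  shows "eps (g n) = eps (g 2)"
  using coset_eq_dihedral(1)[OF coherent_le[OF assms(1,2)]] coherent_carrier[OF assms(1)] by simp

lemma sign_character_eps_lim: "sign_character completion eps_lim"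
  unfolding sign_character_def
proof (intro conjI ballI)
  fix x assume "x \<in> carrier completion"
  then obtain g where g: "coherent F g" "x = coherent_lim F g" by (rule completion_coherent_lim)
  then show "eps_lim x * eps_lim x = 1"
    using eps[OF coherent_carrier[OF g(1), of 2]] by (auto simp: eps_lim_coherent_lim)
  fix y assume "y \<in> carrier completion"
  then obtain h where h: "coherent F h" "y = coherent_lim F h" by (rule completion_coherent_lim)
  with g show "eps_lim (x \<otimes>\<^bsub>completion\<^esub> y) = eps_lim x * eps_lim y"
    by (simp add: coherent_lim_mult coherent_mult eps_lim_coherent_lim eps_mult coherent_carrier)
qed

lemma crossed_hom_psi_lim:
  assumes L: "null_functional L"
  shows "crossed_hom completion eps_lim (psi_lim L)"
  unfolding crossed_hom_def
proof (intro ballI)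
  fix x y assume x: "x \<in> carrier completion" and y: "y \<in> carrier completion"
  obtain g where g: "coherent F g" "x = coherent_lim F g" using x by (rule completion_coherent_lim)
  obtain h where h: "coherent F h" "y = coherent_lim F h" using y by (rule completion_coherent_lim)
  let ?p = "\<lambda>n. of_int (psi (g n)) :: rat" and ?q = "\<lambda>n. of_int (psi (h n)) :: rat"
  have "(eps (g n) - eps (g 2)) * psi (h n) = 0" if "n \<ge> 2" for n
    using eps_coherent[OF g(1) that] by (simp only: diff_self mult_zero_left)
  then have "null_2adic (\<lambda>n. of_int ((eps (g n) - eps (g 2)) * psi (h n)))"
    by (intro null_2adic_of_int[of 2]) (simp only: mult_zero_right dvd_0_right)
  then have "null_2adic (\<lambda>n. of_int (psi (g n \<otimes> h n)) - (?p n + of_int (eps (g 2)) * ?q n))"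
    using coherent_carrier[OF g(1)] coherent_carrier[OF h(1)] by (simp add: psi_mult algebra_simps)
  from null_functional_cong[OF L this]
  have "psi_lim L (x \<otimes>\<^bsub>completion\<^esub> y) = L (\<lambda>n. ?p n + of_int (eps (g 2)) * ?q n)"
    using g h L by (simp add: coherent_lim_mult coherent_mult psi_lim_coherent_lim)
  also have "\<dots> = L ?p + of_int (eps (g 2)) * L ?q"
    using L by (simp add: null_functional_def)
  finally show "psi_lim L (x \<otimes>\<^bsub>completion\<^esub> y) = psi_lim L x + eps_lim x * psi_lim L y"
    using g h L by (simp add: psi_lim_coherent_lim eps_lim_coherent_lim)
qed

end

section \<open>Elements with prescribed 2-adic image\<close>

locale dihedral_hom_generators = dihedral_hom +
  fixes a b
  assumes a: "a \<in> carrier F" "eps a = -1" "psi a = 0"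
    and b: "b \<in> carrier F" "eps b = 1" "psi b = 1"
begin

text \<open>\<open>[\<dots>[[b, a], a], \<dots>, a]\<close> with \<open>n\<close> entries \<open>a\<close> lies in \<open>\<gamma>\<^sub>n\<^sub>+\<^sub>1\<close> and has dihedral image \<open>2\<^sup>n\<close>. So
  infinite products of these elements converge, and realize all 2-adic integers by their binary
  digits.\<close>

primrec iterated_commutator :: "nat \<Rightarrow> 'a"
  where
    "iterated_commutator 0 = b"
  | "iterated_commutator (Suc n) = commutator F (iterated_commutator n) a"

primrec digit_prod :: "nat set \<Rightarrow> nat \<Rightarrow> 'a"
  where
    "digit_prod D 0 = \<one>"
  | "digit_prod D (Suc n) = (if n \<in> D then iterated_commutator n \<otimes> digit_prod D n else digit_prod D n)"

lemma iterated_commutator: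
  "iterated_commutator n \<in> \<gamma> (Suc n) \<and> eps (iterated_commutator n) = 1 \<and>
    psi (iterated_commutator n) = 2 ^ n"
proof (induction n)
  case (Suc n)
  then have "iterated_commutator n \<in> carrier F" by (blast dest: lower_central_carrier)
  with Suc a commutator_in_lower_central[of _ "Suc n" a] show ?case
    by (simp add: eps_commutator psi_commutator)
qed (simp add: b)

lemma iterated_commutator_carrier [simp]: "iterated_commutator n \<in> carrier F"
  using iterated_commutator lower_central_carrier by blast

lemma digit_prod:
  "digit_prod D n \<in> carrier F \<and> eps (digit_prod D n) = 1 \<and> psi (digit_prod D n) = digit_sums D n"
  using iterated_commutator by (induction n) (auto simp: eps_mult psi_mult)

lemma coherent_digit_prod: "coherent F (digit_prod D)"
  unfolding coherent_def
proof (intro allI conjI)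
  fix n
  show "digit_prod D n \<in> carrier F" using digit_prod by blast
  have "iterated_commutator n \<in> \<gamma> n"
    using iterated_commutator lower_central_Suc_subset by blast
  then show "\<gamma> n #> digit_prod D (Suc n) = \<gamma> n #> digit_prod D n"
    using digit_prod[of D n] subgroup.one_closed[OF lower_central_subgroup]
    by (simp add: lower_central_coset_eq_iff m_assoc)
qed

definition digit_elem :: "nat set \<Rightarrow> nat \<Rightarrow> 'a set"
  where "digit_elem D = coherent_lim F (digit_prod D)"

lemma digit_elem_carrier: "digit_elem D \<in> carrier completion"
  unfolding digit_elem_def by (rule coherent_lim_carrier[OF coherent_digit_prod])

lemma eps_lim_digit_elem: "eps_lim (digit_elem D) = 1"
  unfolding digit_elem_def eps_lim_coherent_lim[OF coherent_digit_prod] using digit_prod by simp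

lemma psi_lim_digit_elem:
  "null_functional L \<Longrightarrow> psi_lim L (digit_elem D) = L (\<lambda>n. of_int (digit_sums D n))"
  unfolding digit_elem_def using digit_prod by (simp add: psi_lim_coherent_lim coherent_digit_prod)

lemma uncountable_completion: "uncountable (carrier completion)"
proof -
  have "inj digit_elem"
  proof (rule injI)
    fix D E assume "digit_elem D = digit_elem E"
    then have "null_2adic (\<lambda>n. of_int (psi (digit_prod D n)) - of_int (psi (digit_prod E n)))"
      unfolding digit_elem_def
      by (rule coherent_lim_eq_dihedral(2)[OF coherent_digit_prod coherent_digit_prod])
    then show "D = E" using digit_prod by (intro digit_sums_inj) simp
  qed
  then have "uncountable (range digit_elem)"
    using uncountable_nat_sets countable_image_inj_on by blast
  moreover have "range digit_elem \<subseteq> carrier completion" using digit_elem_carrier by blast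
  ultimately show ?thesis using countable_subset by blast
qed

text \<open>Choose \<open>u\<close> and \<open>v\<close> such that their images in the 2-adic integers are linearly independent
  over the rationals together with 1, and functionals that separate them and vanish on 1.\<close>

lemma commutator_closed_homology:
  assumes xs: "distinct xs" "set xs \<subseteq> carrier F" "a \<in> set xs"
    and eps_xs: "\<And>x. x \<in> set xs \<Longrightarrow> x \<noteq> a \<Longrightarrow> eps x = 1"
  obtains u v where "u \<in> carrier completion" "v \<in> carrier completion"
    "\<And>H. commutator_closed_subgroup xs H \<Longrightarrow> u \<in> H \<Longrightarrow> v \<in> H \<Longrightarrow>
      \<not> trivial_group (group_homology 2 (completion\<lparr>carrier := H\<rparr>))"
proof -
  obtain E where E: "(\<lambda>n. of_int (digit_sums E n)) \<notin> null_span (\<lambda>_. 0)"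
    using digit_sums_notin_null_span by blast
  define q where "q = (\<lambda>n. of_int (digit_sums E n) :: rat)"
  obtain D where D: "(\<lambda>n. of_int (digit_sums D n)) \<notin> null_span q"
    using digit_sums_notin_null_span by blast
  define p where "p = (\<lambda>n. of_int (digit_sums D n) :: rat)"
  obtain L where L: "null_functional L" "\<And>c. L (\<lambda>_. c) = 0" "L p = 1" "L q = 0"
  proof (rule null_span_functional[OF D[folded p_def]])
    fix L assume "\<And>p q. L (\<lambda>n. p n + q n) = L p + L q" "\<And>c q. L (\<lambda>n. c * q n) = c * L q"
      "\<And>r. r \<in> null_span q \<Longrightarrow> L r = 0" "L p = 1"
    then show thesis
      using that[of L] null_2adic_in_null_span const_in_null_span self_in_null_span
      by (simp add: null_functional_def)
  qed
  obtain M where M: "null_functional M" "\<And>c. M (\<lambda>_. c) = 0" "M q = 1"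
  proof (rule null_span_functional[OF E[folded q_def]])
    fix M assume "\<And>p q. M (\<lambda>n. p n + q n) = M p + M q" "\<And>c q. M (\<lambda>n. c * q n) = c * M q"
      "\<And>r. r \<in> null_span (\<lambda>_. 0) \<Longrightarrow> M r = 0" "M q = 1"
    then show thesis
      using that[of M] null_2adic_in_null_span const_in_null_span
      by (simp add: null_functional_def)
  qed
  let ?u = "digit_elem D" and ?v = "digit_elem E"
  let ?l = "psi_lim L" and ?m = "psi_lim M" and ?\<iota> = "completion_map F"
  interpret C: group completion by (rule group_completion)
  have gens: "?l (?\<iota> x) = 0" "?m (?\<iota> x) = 0" "eps_lim (?\<iota> x) = of_int (eps x)"
    if "x \<in> carrier F" for x
    using that L M by (simp_all add: completion_map_eq_lim psi_lim_coherent_lim eps_lim_coherent_lim coherent_const)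
  show thesis
  proof (rule that[of ?u ?v])
    fix H assume H: "commutator_closed_subgroup xs H" and uv: "?u \<in> H" "?v \<in> H"
    have sub: "subgroup H completion" and map: "?\<iota> ` carrier F \<subseteq> H"
      using H by (auto simp: commutator_closed_subgroup_def)
    let ?H = "completion\<lparr>carrier := H\<rparr>"
    interpret sub: subgroup H completion by (rule sub)
    interpret H: group ?H using sub group_completion by (rule subgroup.subgroup_is_group)
    have comm: "commutator ?H x y = commutator completion x y" if "x \<in> H" "y \<in> H" for x y
      using commutator_restrict[OF group_completion sub that] .
    have "commutator completion ?u ?v (Suc 1) = \<gamma> (Suc 1)"
      using uv sub.mem_carrier completion_level_one by (intro commutator_level) auto
    moreover have "commutator completion ?u ?v \<in> H"
      using H.commutator_closed[of ?u ?v] uv comm by simp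
    ultimately obtain s where s: "\<forall>x\<in>set xs. s x \<in> H"
      and uv_eq: "commutator completion ?u ?v = commutator_prod completion s ?\<iota> xs"
      using H unfolding commutator_closed_subgroup_def by (meson le_refl)
    have \<iota>H: "?\<iota> x \<in> H" if "x \<in> set xs" for x using that xs map by auto
    have "commutator_prod ?H s ?\<iota> ys = commutator_prod completion s ?\<iota> ys" if "set ys \<subseteq> set xs" for ys
      using that s \<iota>H by (induction ys) (simp_all add: comm)
    then have "commutator ?H ?u ?v = commutator_prod ?H s ?\<iota> xs"
      using uv comm uv_eq by simp
    moreover have "sign_character ?H eps_lim"
      using sign_character_eps_lim sub.mem_carrier by (simp add: sign_character_def)
    moreover have "crossed_hom ?H eps_lim ?l" "crossed_hom ?H eps_lim ?m"
      using crossed_hom_psi_lim[OF L(1)] crossed_hom_psi_lim[OF M(1)] sub.mem_carrier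
      by (simp_all add: crossed_hom_def)
    moreover have "?l ?u * ?m ?v - ?l ?v * ?m ?u \<noteq> 0"
      using L M by (simp add: psi_lim_digit_elem flip: p_def q_def)
    moreover have "eps_lim (?\<iota> a) = -1" using gens(3)[OF a(1)] a(2) by simp
    moreover have "eps_lim (?\<iota> x) = 1" if "x \<in> set xs" "x \<noteq> a" for x
      using gens(3)[of x] eps_xs[OF that] that xs by auto
    moreover have "?l (?\<iota> x) = 0 \<and> ?m (?\<iota> x) = 0" if "x \<in> set xs" for x
      using gens[of x] that xs by auto
    ultimately show "\<not> trivial_group (group_homology 2 ?H)"
      using s \<iota>H uv xs eps_lim_digit_elem
      by (intro H.homology_2_nontrivial_of_crossed_homs[of eps_lim ?l ?m ?u ?v s xs ?\<iota> a]) auto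
  qed (rule digit_elem_carrier)+
qed

end

section \<open>Uncountably many parafree subgroups\<close>

theorem mainTheorem4:
  fixes F :: "('a, 'b) monoid_scheme" and S :: "'a set"
  assumes "free_group_on F S" and "finite S" and "card S \<ge> 2"
  shows "\<exists>\<P> :: (nat \<Rightarrow> 'a set) set set. uncountable \<P> \<and>
           (\<forall>G\<in>\<P>. countable G \<and> parafree_subgroup F G \<and>
              \<not> trivial_group (group_homology 2 ((pronilpotent_completion F)\<lparr>carrier := G\<rparr>)))"
proof -
  let ?C = "pronilpotent_completion F"
  interpret F: group F using assms(1) by (simp add: free_group_on_def)
  have S: "S \<subseteq> carrier F" using assms(1) by (simp add: free_group_on_def)
  obtain xs where xs: "set xs = S" "distinct xs"
    using finite_distinct_list[OF assms(2)] by blast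
  have gen: "generate F (set xs) = carrier F"
    using free_group_generate[OF assms(1)] xs by simp
  have countable_F: "countable (carrier F)"
    using free_group_countable[OF assms(1)] assms(2) by (simp add: countable_finite)
  have "\<not> card S \<le> Suc 0" using assms(3) by simp
  then obtain a b where ab: "a \<in> S" "b \<in> S" "a \<noteq> b"
    using card_le_Suc0_iff_eq[OF assms(2)] by blast
  obtain eps psi where hom: "dihedral_hom F eps psi"
    and on_S: "\<And>x. x \<in> S \<Longrightarrow> eps x = (if x = a then -1 else 1) \<and> psi x = (if x = b then 1 else 0)"
    by (rule free_group_dihedral_hom[OF assms(1), of "\<lambda>x. if x = a then -1 else 1" "\<lambda>x. if x = b then 1 else 0"])
      auto
  interpret dihedral_hom F eps psi by (rule hom)
  interpret dihedral_hom_generators F eps psi a b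
    by unfold_locales (use ab S on_S in auto)
  obtain u v where uv: "u \<in> carrier ?C" "v \<in> carrier ?C"
    and homology: "\<And>H. F.commutator_closed_subgroup xs H \<Longrightarrow> u \<in> H \<Longrightarrow> v \<in> H \<Longrightarrow>
      \<not> trivial_group (group_homology 2 (?C\<lparr>carrier := H\<rparr>))"
  proof (rule commutator_closed_homology[OF xs(2)])
    show "set xs \<subseteq> carrier F" "a \<in> set xs" using xs S ab by auto
    show "eps x = 1" if "x \<in> set xs" "x \<noteq> a" for x using on_S[of x] that xs by simp
  qed (rule that)
  define \<P> where "\<P> = {G. countable G \<and> parafree_subgroup F G \<and>
    \<not> trivial_group (group_homology 2 (?C\<lparr>carrier := G\<rparr>))}"
  \<comment> \<open>Every element of the completion lies in a member of \<open>\<P>\<close>. As the members are countable and the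
    completion is not, \<open>\<P>\<close> is uncountable.\<close>
  have "carrier ?C \<subseteq> \<Union>\<P>"
  proof
    fix w assume w: "w \<in> carrier ?C"
    have "countable {u, v, w}" "{u, v, w} \<subseteq> carrier ?C" "set xs \<subseteq> carrier F"
      using uv w xs S by auto
    then obtain H where "countable H" "{u, v, w} \<subseteq> H" "F.commutator_closed_subgroup xs H"
      using F.commutator_closed_hull[OF xs(2) _ gen countable_F] by metis
    then have "H \<in> \<P>"
      using homology[of H] F.commutator_closed_parafree[of xs H] xs S by (simp add: \<P>_def)
    with \<open>{u, v, w} \<subseteq> H\<close> show "w \<in> \<Union>\<P>" by auto
  qed
  moreover have "countable (\<Union>\<P>)" if "countable \<P>"
    using countable_UN[OF that, of "\<lambda>G. G"] by (simp add: \<P>_def)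
  ultimately have "uncountable \<P>"
    using uncountable_completion countable_subset by blast
  then show ?thesis by (intro exI[of _ \<P>]) (auto simp: \<P>_def)
qed

end
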